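(* Let $r,d\ge0$ be integers, let $R=\mathbb{R}[x_1,\dots,x_n]$, and let $\Delta$ be a finite strongly connected $n$-dimensional simplicial complex embedded in $\mathbb{R}^n$ such that the link of each simplex of $\Delta$ is also strongly connected. Let $(G_\Delta,\alpha_\Delta)$ be its edge-labeled dual graph and suppose that every ideal $\alpha_\Delta(uv)$ is a principal ideal generated by a homogeneous element of $R$. Let $I_{d+1}$ be the ideal of $R$ generated by all homogeneous elements of degree $d+1$ and $\pi\colon R\to R/I_{d+1}$ the quotient map. For $F$ a piecewise polynomial on $\Delta$ (one polynomial $F|_{\sigma_v}$ for each $n$-simplex $\sigma_v$) of degree at most $d$, let $\varphi(F)$ be the function on the vertices of $G_\Delta$ with $\varphi(F)_v=\pi(F|_{\sigma_v})$. Then $F\in S^r_d(\Delta)$ if and only if $\varphi(F)\in (R/I_{d+1})_{G_\Delta,\pi\circ(\alpha_\Delta)^{r+1}}$. Moreover, the map $$\varphi\colon S^r_d(\Delta)\to (R/I_{d+1})_{G_\Delta,\pi\circ(\alpha_\Delta)^{r+1}}$$ is an isomorphism of $\mathbb{R}$-vector spaces and respects multiplication in the following senses: - if $f\in\mathbb{R}[x_1,\dots,x_n]$ and $F\in S^r_d(\Delta)$ satisfy $fF\in S^r_d(\Delta)$, then $\varphi(fF)=f\varphi(F)=\pi(f)\varphi(F)$; - if $F_1,F_2\in S^r_d(\Delta)$ satisfy $F_1F_2\in S^r_d(\Delta)$, then $\varphi(F_1F_2)=\varphi(F_1)\varphi(F_2)$.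
   Context: Strongly connected: a pure simplicial complex is strongly connected if any two of its maximal simplices can be joined by a sequence of maximal simplices in which consecutive ones share a face of codimension one. $S^r_d(\Delta)$ is the real vector space of functions $F\colon\Delta\to\mathbb{R}$ whose restriction to each $n$-simplex $\sigma_v$ of $\Delta$ is a polynomial of degree at most $d$ and which are continuously differentiable of order $r$ (that is, $\mathcal{C}^r$) on $\Delta\subseteq\mathbb{R}^n$. The dual graph $G_\Delta$ has one vertex $v$ for each $n$-simplex $\sigma_v$ of $\Delta$ and an edge $uv$ whenever $\sigma_u\cap\sigma_v$ is an $(n-1)$-dimensional simplex. The dual edge-labeling $\alpha_\Delta$ assigns to $uv$ the principal ideal of $R$ generated by any nonzero affine linear form vanishing on $\sigma_u\cap\sigma_v$. The edge-labeling $(\alpha_\Delta)^{r+1}$ assigns to $uv$ the ideal $\alpha_\Delta(uv)^{r+1}$, and $\pi\circ(\alpha_\Delta)^{r+1}$ assigns to $uv$ the ideal $\pi(\alpha_\Delta(uv)^{r+1})$ of $R/I_{d+1}$. For a commutative ring $S$ and an edge-labeling $\beta$ of a graph $G=(V,E)$ by ideals of $S$, $S_{G,\beta}$ denotes the ring (and $S$-module), under coordinatewise operations, of splines: vectors $\mathbf{p}\in\bigoplus_{v\in V}S$ with $\mathbf{p}_u-\mathbf{p}_v\in\beta(uv)$ for every edge $uv\in E$. An element $f\in R$ acts on splines over $R/I_{d+1}$ through $\pi(f)$. *)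

theory Defs
  imports
    "HOL-Analysis.Analysis"
    "HOL-Library.Poly_Mapping"
    "HOL-Algebra.QuotRing"
    "HOL-Algebra.Ideal_Product"
    "HOL-Algebra.Module"
    "HOL-Algebra.Algebraic_Closure_Type"
begin

section \<open>The polynomial ring R\<close>

text \<open>
  Variables are indexed by the finite type \<open>'n\<close>, which is also the index type of
  the ambient space \<open>real ^ 'n\<close>, so that n is \<open>CARD('n)\<close>.  Multiplication on
  \<open>'n mpoly\<close> is the convolution product of \<open>Poly_Mapping\<close>.
\<close>

type_synonym 'n mpoly = "('n \<Rightarrow>\<^sub>0 nat) \<Rightarrow>\<^sub>0 real"

definition mono_degree :: "('n::finite \<Rightarrow>\<^sub>0 nat) \<Rightarrow> nat" where
  "mono_degree m = (\<Sum>i\<in>UNIV. Poly_Mapping.lookup m i)"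

definition degree_le :: "nat \<Rightarrow> 'n::finite mpoly \<Rightarrow> bool" where
  "degree_le d p \<longleftrightarrow> (\<forall>m\<in>Poly_Mapping.keys p. mono_degree m \<le> d)"

definition homogeneous_of :: "nat \<Rightarrow> 'n::finite mpoly \<Rightarrow> bool" where
  "homogeneous_of k p \<longleftrightarrow> (\<forall>m\<in>Poly_Mapping.keys p. mono_degree m = k)"

definition homogeneous :: "'n::finite mpoly \<Rightarrow> bool" where
  "homogeneous p \<longleftrightarrow> (\<exists>k. homogeneous_of k p)"

definition poly_eval :: "'n::finite mpoly \<Rightarrow> real ^ 'n \<Rightarrow> real" where
  "poly_eval p x =
     (\<Sum>m\<in>Poly_Mapping.keys p. Poly_Mapping.lookup p m * (\<Prod>i\<in>UNIV. (x $ i) ^ Poly_Mapping.lookup m i))"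

definition poly_const :: "real \<Rightarrow> 'n::finite mpoly" where
  "poly_const c = Poly_Mapping.single 0 c"

abbreviation mpoly_ring :: "'n::finite mpoly ring" where
  "mpoly_ring \<equiv> ring_of_type_algebra"

abbreviation real_ring :: "real ring" where
  "real_ring \<equiv> ring_of_type_algebra"

definition trunc_ideal :: "nat \<Rightarrow> 'n::finite mpoly set" where
  "trunc_ideal k = Idl\<^bsub>mpoly_ring\<^esub> {p. homogeneous_of k p}"

definition trunc_ring :: "nat \<Rightarrow> 'n::finite mpoly set ring" where
  "trunc_ring k = mpoly_ring Quot trunc_ideal k"

definition trunc_map :: "nat \<Rightarrow> 'n::finite mpoly \<Rightarrow> 'n mpoly set" where
  "trunc_map k p = trunc_ideal k +>\<^bsub>mpoly_ring\<^esub> p"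

primrec ideal_power :: "('a, 'b) ring_scheme \<Rightarrow> 'a set \<Rightarrow> nat \<Rightarrow> 'a set" where
  "ideal_power R J 0 = carrier R"
| "ideal_power R J (Suc k) = ideal_prod R J (ideal_power R J k)"


section \<open>Simplicial complexes\<close>

text \<open>
  We use \<^const>\<open>simplicial_complex\<close>.  A nonempty complex in this sense contains the
  empty simplex, whose \<^const>\<open>aff_dim\<close> is \<open>-1\<close>.  This matters for strong
  connectedness of links: the link of an interior simplex of codimension one consists of
  two points and the empty simplex, and the two points share the empty simplex as a face
  of codimension one.
\<close>

definition complex_dim :: "int \<Rightarrow> 'a::euclidean_space set set \<Rightarrow> bool" where
  "complex_dim k \<Delta> \<longleftrightarrow> (\<exists>\<sigma>\<in>\<Delta>. aff_dim \<sigma> = k) \<and> (\<forall>\<sigma>\<in>\<Delta>. aff_dim \<sigma> \<le> k)"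

definition maximal_simplices :: "'a set set \<Rightarrow> 'a set set" where
  "maximal_simplices \<Delta> = {\<sigma>\<in>\<Delta>. \<forall>\<tau>\<in>\<Delta>. \<sigma> \<subseteq> \<tau> \<longrightarrow> \<tau> = \<sigma>}"

definition pure_complex :: "'a::euclidean_space set set \<Rightarrow> bool" where
  "pure_complex \<Delta> \<longleftrightarrow>
     (\<forall>\<sigma>\<in>maximal_simplices \<Delta>. \<forall>\<tau>\<in>maximal_simplices \<Delta>. aff_dim \<sigma> = aff_dim \<tau>)"

definition share_codim1_face :: "'a::euclidean_space set \<Rightarrow> 'a set \<Rightarrow> bool" where
  "share_codim1_face \<sigma> \<tau> \<longleftrightarrow>
     (\<exists>\<rho>. \<rho> face_of \<sigma> \<and> \<rho> face_of \<tau> \<and> aff_dim \<rho> = aff_dim \<sigma> - 1 \<and> aff_dim \<rho> = aff_dim \<tau> - 1)"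

definition strongly_connected :: "'a::euclidean_space set set \<Rightarrow> bool" where
  "strongly_connected \<Delta> \<longleftrightarrow> pure_complex \<Delta> \<and>
     (\<forall>\<sigma>\<in>maximal_simplices \<Delta>. \<forall>\<tau>\<in>maximal_simplices \<Delta>.
        (\<lambda>\<alpha> \<beta>. \<alpha> \<in> maximal_simplices \<Delta> \<and> \<beta> \<in> maximal_simplices \<Delta> \<and> share_codim1_face \<alpha> \<beta>)\<^sup>*\<^sup>* \<sigma> \<tau>)"

text \<open>
  A simplex of \<open>\<Delta>\<close> is the join of its faces \<open>\<sigma>\<close> and \<open>\<tau>\<close> iff it is the convex hull of
  their union.
\<close>

definition link :: "'a::euclidean_space set set \<Rightarrow> 'a set \<Rightarrow> 'a set set" where
  "link \<Delta> \<sigma> = {\<tau>\<in>\<Delta>. \<sigma> \<inter> \<tau> = {} \<and> convex hull (\<sigma> \<union> \<tau>) \<in> \<Delta>}"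


section \<open>The edge-labeled dual graph\<close>

text \<open>
  A graph is a vertex set together with a set of edges, an edge \<open>uv\<close> being the set \<open>{u, v}\<close>.
  The vertices of the dual graph are the n-simplices themselves, so that the
  intersection of the two simplices of an edge \<open>e\<close> is \<open>\<Inter>e\<close>.
\<close>

definition dual_vertices :: "(real ^ 'n) set set \<Rightarrow> (real ^ 'n) set set" where
  "dual_vertices \<Delta> = {\<sigma>\<in>\<Delta>. int CARD('n) simplex \<sigma>}"

definition dual_edges :: "(real ^ 'n) set set \<Rightarrow> (real ^ 'n) set set set" where
  "dual_edges \<Delta> = {{u, v} | u v. u \<in> dual_vertices \<Delta> \<and> v \<in> dual_vertices \<Delta> \<and>
                        (int CARD('n) - 1) simplex (u \<inter> v)}"

text \<open>
  Affine linear forms are the polynomials of degree at most one.  The nonzero ones that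
  vanish on a given (n-1)-simplex are scalar multiples of each other, so the ideal
  does not depend on the choice.
\<close>

definition dual_label :: "(real ^ 'n::finite) set set \<Rightarrow> 'n mpoly set" where
  "dual_label e =
     PIdl\<^bsub>mpoly_ring\<^esub> (SOME l. degree_le 1 l \<and> l \<noteq> 0 \<and> (\<forall>x\<in>\<Inter>e. poly_eval l x = 0))"

text \<open>The edge-labeling of the dual graph by the images in the truncated ring
  of the \<open>k\<close>-th powers of the labels.\<close>

definition trunc_label :: "nat \<Rightarrow> nat \<Rightarrow> (real ^ 'n::finite) set set \<Rightarrow> 'n mpoly set set" where
  "trunc_label m k e = trunc_map m ` ideal_power mpoly_ring (dual_label e) k"


section \<open>Splines on an edge-labeled graph\<close>

text \<open>
  For a finite vertex set \<open>V\<close>, elements of the direct sum over \<open>V\<close> are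
  extensional functions on \<open>V\<close>.  The record carries the coordinatewise ring
  operations as well as the scalar multiplication by elements of \<open>S\<close>.
\<close>

definition graph_splines ::
  "('s, 'b) ring_scheme \<Rightarrow> 'v set \<Rightarrow> 'v set set \<Rightarrow> ('v set \<Rightarrow> 's set) \<Rightarrow> ('s, 'v \<Rightarrow> 's) module" where
  "graph_splines S V E \<beta> =
     \<lparr>carrier = {p \<in> V \<rightarrow>\<^sub>E carrier S. \<forall>u\<in>V. \<forall>v\<in>V. {u, v} \<in> E \<longrightarrow> p u \<ominus>\<^bsub>S\<^esub> p v \<in> \<beta> {u, v}},
      monoid.mult = (\<lambda>p q. \<lambda>v\<in>V. p v \<otimes>\<^bsub>S\<^esub> q v),
      one = (\<lambda>v\<in>V. \<one>\<^bsub>S\<^esub>),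
      zero = (\<lambda>v\<in>V. \<zero>\<^bsub>S\<^esub>),
      add = (\<lambda>p q. \<lambda>v\<in>V. p v \<oplus>\<^bsub>S\<^esub> q v),
      smult = (\<lambda>a p. \<lambda>v\<in>V. a \<otimes>\<^bsub>S\<^esub> p v)\<rparr>"

definition restrict_scalars ::
  "('k \<Rightarrow> 's) \<Rightarrow> ('s, 'a, 'b) module_scheme \<Rightarrow> ('k, 'a) module" where
  "restrict_scalars h M =
     \<lparr>carrier = carrier M, monoid.mult = monoid.mult M, one = one M, zero = zero M, add = add M,
      smult = (\<lambda>a. smult M (h a))\<rparr>"

definition module_iso ::
  "('k, 'm) ring_scheme \<Rightarrow> ('k, 'a, 'b) module_scheme \<Rightarrow> ('k, 'c, 'd) module_scheme
    \<Rightarrow> ('a \<Rightarrow> 'c) \<Rightarrow> bool" where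
  "module_iso K M N f \<longleftrightarrow>
     module K M \<and> module K N \<and> bij_betw f (carrier M) (carrier N) \<and>
     (\<forall>x\<in>carrier M. \<forall>y\<in>carrier M. f (x \<oplus>\<^bsub>M\<^esub> y) = f x \<oplus>\<^bsub>N\<^esub> f y) \<and>
     (\<forall>a\<in>carrier K. \<forall>x\<in>carrier M. f (a \<odot>\<^bsub>M\<^esub> x) = a \<odot>\<^bsub>N\<^esub> f x)"

text \<open>Splines over the quotient of R by the ideal generated by the homogeneous
  polynomials of degree \<open>d + 1\<close>, on the dual graph labeled by the powers with
  exponent \<open>r + 1\<close>.\<close>

definition trunc_splines ::
  "nat \<Rightarrow> nat \<Rightarrow> (real ^ 'n::finite) set set
    \<Rightarrow> ('n mpoly set, (real ^ 'n) set \<Rightarrow> 'n mpoly set) module" where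
  "trunc_splines r d \<Delta> =
     graph_splines (trunc_ring (d + 1)) (dual_vertices \<Delta>) (dual_edges \<Delta>)
       (trunc_label (d + 1) (r + 1))"


section \<open>Spline functions\<close>

text \<open>
  Being of class C^k on a set \<open>S\<close> that need not be open: derivatives are
  Frechet derivatives within \<open>S\<close>, which are unique at the points of a union of
  full-dimensional simplices.
\<close>

primrec Ck_on :: "nat \<Rightarrow> 'a::real_normed_vector set \<Rightarrow> ('a \<Rightarrow> real) \<Rightarrow> bool" where
  "Ck_on 0 S f \<longleftrightarrow> continuous_on S f"
| "Ck_on (Suc k) S f \<longleftrightarrow>
     (\<exists>f'. (\<forall>x\<in>S. (f has_derivative f' x) (at x within S)) \<and> (\<forall>w. Ck_on k S (\<lambda>x. f' x w)))"

text \<open>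
  Functions on the underlying space \<open>\<Union>\<Delta>\<close> are extensional, i.e. undefined
  outside of it.
\<close>

definition spline_functions :: "nat \<Rightarrow> nat \<Rightarrow> (real ^ 'n::finite) set set \<Rightarrow> (real ^ 'n \<Rightarrow> real) set" where
  "spline_functions r d \<Delta> =
     {F \<in> \<Union>\<Delta> \<rightarrow>\<^sub>E UNIV.
        (\<forall>v\<in>dual_vertices \<Delta>. \<exists>p. degree_le d p \<and> (\<forall>x\<in>v. F x = poly_eval p x)) \<and>
        Ck_on r (\<Union>\<Delta>) F}"

text \<open>The real vector space of spline functions.  Of the record, only carrier, zero, addition
  and scalar multiplication are relevant: it is not closed under the multiplication.\<close>

definition spline_space ::
  "nat \<Rightarrow> nat \<Rightarrow> (real ^ 'n::finite) set set \<Rightarrow> (real, real ^ 'n \<Rightarrow> real) module" where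
  "spline_space r d \<Delta> =
     \<lparr>carrier = spline_functions r d \<Delta>,
      monoid.mult = (\<lambda>F G. \<lambda>x\<in>\<Union>\<Delta>. F x * G x),
      one = (\<lambda>x\<in>\<Union>\<Delta>. 1),
      zero = (\<lambda>x\<in>\<Union>\<Delta>. 0),
      add = (\<lambda>F G. \<lambda>x\<in>\<Union>\<Delta>. F x + G x),
      smult = (\<lambda>c F. \<lambda>x\<in>\<Union>\<Delta>. c * F x)\<rparr>"

text \<open>
  A family \<open>P\<close> of polynomials, one for each n-simplex, may assign different values
  to a point common to several n-simplices.  It defines a function on \<open>\<Union>\<Delta>\<close> only if
  there is some \<open>F\<close> as follows.
\<close>

definition restricts_to ::
  "(real ^ 'n::finite) set set \<Rightarrow> (real ^ 'n \<Rightarrow> real) \<Rightarrow> ((real ^ 'n) set \<Rightarrow> 'n mpoly) \<Rightarrow> bool" where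
  "restricts_to \<Delta> F P \<longleftrightarrow> (\<forall>v\<in>dual_vertices \<Delta>. \<forall>x\<in>v. F x = poly_eval (P v) x)"

text \<open>The polynomials are unique because an n-simplex has nonempty interior.\<close>

definition piece :: "(real ^ 'n::finite \<Rightarrow> real) \<Rightarrow> (real ^ 'n) set \<Rightarrow> 'n mpoly" where
  "piece F v = (THE p. \<forall>x\<in>v. F x = poly_eval p x)"

definition phi_family ::
  "nat \<Rightarrow> (real ^ 'n::finite) set set \<Rightarrow> ((real ^ 'n) set \<Rightarrow> 'n mpoly)
    \<Rightarrow> (real ^ 'n) set \<Rightarrow> 'n mpoly set" where
  "phi_family d \<Delta> P = (\<lambda>v\<in>dual_vertices \<Delta>. trunc_map (d + 1) (P v))"

definition phi ::
  "nat \<Rightarrow> (real ^ 'n::finite) set set \<Rightarrow> (real ^ 'n \<Rightarrow> real) \<Rightarrow> (real ^ 'n) set \<Rightarrow> 'n mpoly set" where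
  "phi d \<Delta> F = phi_family d \<Delta> (piece F)"

end

theory Submission
  imports Defs
begin

text \<open>
  Because each edge label has a homogeneous generator, the common facet of two adjacent
  n-simplices lies on a hyperplane through the origin with linear form \<open>l\<close>.  The pieces
  \<open>p\<close>, \<open>q\<close> of a C^r function on adjacent simplices have the same directional derivatives up
  to order \<open>r\<close> on that facet, hence on the whole hyperplane, which forces
  \<open>l ^ (r + 1)\<close> to divide \<open>p - q\<close>.  Conversely, two n-simplices sharing a point \<open>x\<close> are
  joined by a path of n-simplices through \<open>x\<close>, found in the link of their intersection, so
  these divisibilities along edges make all derivatives up to order \<open>r\<close> agree at \<open>x\<close>, and the
  pieces glue to a C^r function.  Finally, since \<open>l ^ (r + 1)\<close> is homogeneous, divisibility
  of a polynomial of degree at most \<open>d\<close> by it can be tested modulo terms of degree above \<open>d\<close>.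
\<close>

unbundle no fps_syntax

section \<open>Polynomials and polynomial functions\<close>

text \<open>Homogeneity is what makes the truncation faithful: an affine form with nonzero constant
  term is a unit in \<open>R/I_(d+1)\<close>, so the edge condition there would be void. Homogeneous
  forms of degree one instead respect the splitting of R into degree at most \<open>d\<close> and
  order above \<open>d\<close>. Divisibility by \<open>l ^ (r + 1)\<close> is reached without
  factorisation theory: polynomial identities are checked by values, and the multiplicity of
  \<open>l\<close> is raised one at a time by differentiating along the normal vector of its
  hyperplane. The obstacle on the analytic side is that \<open>Ck_on\<close> uses derivatives within
  a closed union of simplices, hence also at boundary points of the pieces. Interior points identify
  such a derivative with that of the piece, and continuity carries this to the boundary. As
  \<open>Ck_on\<close> is recursive, both directions are inductions on \<open>r\<close> that replace
  a function and its pieces by their directional derivatives.\<close>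

lemma update_eq_add_single:
  "a \<notin> Poly_Mapping.keys f \<Longrightarrow> Poly_Mapping.update a b f = f + Poly_Mapping.single a b"
  by (intro poly_mapping_eqI) (auto simp: lookup_update lookup_add lookup_single when_def in_keys_iff)

lemma poly_mapping_induct [case_names single add]:
  fixes p :: "'a \<Rightarrow>\<^sub>0 'b::comm_monoid_add"
  assumes single: "\<And>m c. P (Poly_Mapping.single m c)"
    and add: "\<And>p q. P p \<Longrightarrow> P q \<Longrightarrow> P (p + q)"
  shows "P p"
proof (induction p rule: Poly_Mapping.update_induct)
  case const
  show ?case using single[of undefined 0] by simp
next
  case (update f a b)
  have "Poly_Mapping.update a b f = f + Poly_Mapping.single a b"
    using update.hyps(1) by (rule update_eq_add_single)
  then show ?case using add single update.IH by simp
qed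

definition poly_var :: "'n \<Rightarrow> 'n::finite mpoly" where
  "poly_var i = Poly_Mapping.single (Poly_Mapping.single i 1) 1"

text \<open>Constants and variables generate R as a ring, which suffices for properties stable under
  sums and products: restriction to a line, substitution, differentiation.\<close>

lemma mpoly_induct [case_names const var add mult]:
  fixes p :: "'n::finite mpoly"
  assumes const: "\<And>c. P (poly_const c)" and var: "\<And>i. P (poly_var i)"
    and add: "\<And>p q. P p \<Longrightarrow> P q \<Longrightarrow> P (p + q)"
    and mult: "\<And>p q. P p \<Longrightarrow> P q \<Longrightarrow> P (p * q)"
  shows "P p"
proof (induction p rule: poly_mapping_induct)
  case (single m c)
  have pow: "P (Poly_Mapping.single (Poly_Mapping.single i k) 1)" for i and k :: nat
  proof (induction k)
    case 0
    show ?case using const[of 1] by (simp add: poly_const_def)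
  next
    case (Suc k)
    have "Poly_Mapping.single (Poly_Mapping.single i (Suc k)) 1
        = poly_var i * Poly_Mapping.single (Poly_Mapping.single i k) (1::real)"
      by (simp add: poly_var_def mult_single flip: single_add)
    then show ?case using mult var Suc by simp
  qed
  have "P (Poly_Mapping.single m 1)"
  proof (induction m rule: poly_mapping_induct)
    case (single k v)
    show ?case by (rule pow)
  next
    case (add f g)
    have "Poly_Mapping.single (f + g) (1::real) = Poly_Mapping.single f 1 * Poly_Mapping.single g 1"
      by (simp add: mult_single)
    then show ?case using mult add by simp
  qed
  moreover have "Poly_Mapping.single m c = poly_const c * Poly_Mapping.single m 1"
    by (simp add: poly_const_def mult_single)
  ultimately show ?case using mult const by simp
next
  case (add p q)
  then show ?case using assms(3) by blast
qed

section \<open>Evaluation as a ring homomorphism\<close>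

lemma poly_eval_superset:
  assumes "finite K" "Poly_Mapping.keys p \<subseteq> K"
  shows "poly_eval p x =
    (\<Sum>m\<in>K. Poly_Mapping.lookup p m * (\<Prod>i\<in>UNIV. (x $ i) ^ Poly_Mapping.lookup m i))"
  unfolding poly_eval_def using assms
  by (intro sum.mono_neutral_left) (auto simp: in_keys_iff)

lemma poly_eval_add [simp]: "poly_eval (p + q) x = poly_eval p x + poly_eval q x"
proof -
  let ?K = "Poly_Mapping.keys p \<union> Poly_Mapping.keys q"
  have "Poly_Mapping.keys (p + q) \<subseteq> ?K" by (rule keys_add)
  then show ?thesis
    by (simp add: poly_eval_superset[of ?K] lookup_add sum.distrib distrib_right)
qed

lemma poly_eval_single [simp]:
  "poly_eval (Poly_Mapping.single m c) x = c * (\<Prod>i\<in>UNIV. (x $ i) ^ Poly_Mapping.lookup m i)"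
  by (simp add: poly_eval_superset[of "{m}"])

lemma poly_eval_const [simp]: "poly_eval (poly_const c) x = c"
  by (simp add: poly_const_def)

lemma poly_eval_0 [simp]: "poly_eval 0 x = 0"
  by (simp add: poly_eval_def)

lemma poly_eval_1 [simp]: "poly_eval 1 x = 1"
  using poly_eval_const[of 1 x] by (simp add: poly_const_def)

lemma poly_eval_var [simp]: "poly_eval (poly_var i) x = x $ i"
proof -
  have "(\<Prod>j\<in>UNIV. (x $ j) ^ (if i = j then Suc 0 else 0)) = (\<Prod>j\<in>UNIV. if i = j then x $ j else 1)"
    by (intro prod.cong) auto
  then show ?thesis by (simp add: poly_var_def lookup_single when_def)
qed

lemma poly_eval_mult [simp]: "poly_eval (p * q) x = poly_eval p x * poly_eval q x"
proof (induction p rule: poly_mapping_induct)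
  case (single m c)
  show ?case
  proof (induction q rule: poly_mapping_induct)
    case (single m' c')
    show ?case by (simp add: mult_single lookup_add power_add prod.distrib)
  next
    case (add p q)
    then show ?case by (simp add: algebra_simps)
  qed
next
  case (add p q)
  then show ?case by (simp add: algebra_simps)
qed

lemma poly_eval_uminus [simp]: "poly_eval (- p) x = - poly_eval p x"
  using poly_eval_add[of p "- p" x] by simp

lemma poly_eval_diff [simp]: "poly_eval (p - q) x = poly_eval p x - poly_eval q x"
  using poly_eval_add[of p "- q" x] by simp

lemma poly_eval_power [simp]: "poly_eval (p ^ k) x = poly_eval p x ^ k"
  by (induction k) auto

lemma poly_eval_sum [simp]: "poly_eval (sum p I) x = (\<Sum>i\<in>I. poly_eval (p i) x)"
  by (induction I rule: infinite_finite_induct) auto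

text \<open>The identity theorem for polynomials, with one variable eliminated per step. The sum in
  the conclusion collects all monomials that agree with \<open>m0\<close> on \<open>A\<close>,
  because variables outside \<open>A\<close> are not evaluated and monomials may differ there; for
  \<open>A = UNIV\<close> at most \<open>m0\<close> itself remains.\<close>

lemma monomial_sum_eq_0:
  fixes c :: "('n \<Rightarrow>\<^sub>0 nat) \<Rightarrow> real"
  assumes "finite A" "finite K"
    and "\<And>x :: 'n \<Rightarrow> real. (\<Sum>m\<in>K. c m * (\<Prod>i\<in>A. x i ^ Poly_Mapping.lookup m i)) = 0"
  shows "(\<Sum>m | m \<in> K \<and> (\<forall>i\<in>A. Poly_Mapping.lookup m i = Poly_Mapping.lookup m0 i). c m) = 0"
  using assms
proof (induction A arbitrary: K rule: finite_induct)
  case empty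
  then show ?case by simp
next
  case (insert a A)
  let ?K = "{m\<in>K. Poly_Mapping.lookup m a = Poly_Mapping.lookup m0 a}"
  have "(\<Sum>m\<in>?K. c m * (\<Prod>i\<in>A. x i ^ Poly_Mapping.lookup m i)) = 0" for x :: "'n \<Rightarrow> real"
  proof -
    let ?b = "\<lambda>m. c m * (\<Prod>i\<in>A. x i ^ Poly_Mapping.lookup m i)"
    \<comment> \<open>With the variables in \<open>A\<close> frozen at \<open>x\<close>, the sum is
      a polynomial in the value \<open>t\<close> of the variable \<open>a\<close>. It vanishes for
      every \<open>t\<close>, so each coefficient does, and the one at the exponent of
      \<open>a\<close> in \<open>m0\<close> is the sum over \<open>?K\<close>.\<close>
    define q where "q = (\<Sum>m\<in>K. Polynomial.monom (?b m) (Poly_Mapping.lookup m a))"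
    have "poly q t = 0" for t
    proof -
      have "(\<Prod>i\<in>insert a A. (x(a := t)) i ^ Poly_Mapping.lookup m i)
          = t ^ Poly_Mapping.lookup m a * (\<Prod>i\<in>A. x i ^ Poly_Mapping.lookup m i)" for m
      proof -
        have "(\<Prod>i\<in>A. (x(a := t)) i ^ Poly_Mapping.lookup m i) = (\<Prod>i\<in>A. x i ^ Poly_Mapping.lookup m i)"
          using insert.hyps by (intro prod.cong) auto
        then show ?thesis using insert.hyps by (simp del: fun_upd_apply) simp
      qed
      then show ?thesis using insert.prems(2)[of "x(a := t)"]
        by (simp add: q_def poly_sum poly_monom mult_ac del: fun_upd_apply prod.insert)
    qed
    then have "q = 0" using poly_all_0_iff_0 by blast
    then have "Polynomial.coeff q (Poly_Mapping.lookup m0 a) = 0" by simp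
    then show ?thesis
      using insert.prems(1) by (simp add: q_def Polynomial.coeff_sum sum.inter_filter if_distrib cong: if_cong)
  qed
  from insert.IH[OF _ this] insert.prems(1)
  have "(\<Sum>m | m \<in> ?K \<and> (\<forall>i\<in>A. Poly_Mapping.lookup m i = Poly_Mapping.lookup m0 i). c m) = 0"
    by simp
  then show ?case by (simp add: conj_ac)
qed

lemma poly_eval_inject:
  assumes "\<And>x. poly_eval p x = poly_eval q x"
  shows "p = q"
proof -
  have "Poly_Mapping.lookup (p - q) m0 = 0" for m0
  proof -
    let ?K = "Poly_Mapping.keys (p - q)"
    have "(\<Sum>m\<in>?K. Poly_Mapping.lookup (p - q) m * (\<Prod>i\<in>UNIV. y i ^ Poly_Mapping.lookup m i)) = 0"
      for y :: "'a \<Rightarrow> real"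
    proof -
      have "poly_eval (p - q) (\<chi> i. y i) = 0" using assms by simp
      then show ?thesis by (simp add: poly_eval_def)
    qed
    from monomial_sum_eq_0[OF _ _ this, of m0]
    have "(\<Sum>m | m \<in> ?K \<and> (\<forall>i\<in>UNIV. Poly_Mapping.lookup m i = Poly_Mapping.lookup m0 i).
        Poly_Mapping.lookup (p - q) m) = 0"
      by simp
    moreover have "{m \<in> ?K. \<forall>i\<in>UNIV. Poly_Mapping.lookup m i = Poly_Mapping.lookup m0 i} = ?K \<inter> {m0}"
      by (auto intro: poly_mapping_eqI)
    ultimately show ?thesis
      by (cases "m0 \<in> ?K") (auto simp: in_keys_iff)
  qed
  then have "p - q = 0" by (intro poly_mapping_eqI) simp
  then show ?thesis by simp
qed

lemma poly_eval_of_nat [simp]: "poly_eval (of_nat k) x = of_nat k"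
  by (induction k) auto

section \<open>Zeros of polynomials on lines and convex sets\<close>

lemma poly_eval_line: "\<exists>q :: real poly. \<forall>t. poly q t = poly_eval p (x + t *\<^sub>R w)"
proof (induction p rule: mpoly_induct)
  case (const c)
  then show ?case by (intro exI[of _ "[:c:]"]) simp
next
  case (var i)
  then show ?case by (intro exI[of _ "[:x $ i, w $ i:]"]) simp
next
  case (add p q)
  then obtain p' q' :: "real poly" where "\<forall>t. poly p' t = poly_eval p (x + t *\<^sub>R w)"
    "\<forall>t. poly q' t = poly_eval q (x + t *\<^sub>R w)"
    by blast
  then show ?case by (intro exI[of _ "p' + q'"]) simp
next
  case (mult p q)
  then obtain p' q' :: "real poly" where "\<forall>t. poly p' t = poly_eval p (x + t *\<^sub>R w)"
    "\<forall>t. poly q' t = poly_eval q (x + t *\<^sub>R w)"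
    by blast
  then show ?case by (intro exI[of _ "p' * q'"]) simp
qed

text \<open>Near a relative interior point \<open>x\<close> of \<open>S\<close>, the line towards
  \<open>y\<close> stays in \<open>S\<close>. The restriction of \<open>p\<close> to that line
  therefore has infinitely many roots and vanishes identically, also at the parameter value 1, which
  is \<open>y\<close>.\<close>

lemma poly_eval_zero_affine_hull:
  fixes S :: "(real ^ 'n::finite) set"
  assumes "convex S" and zero: "\<And>x. x \<in> S \<Longrightarrow> poly_eval p x = 0" and y: "y \<in> affine hull S"
  shows "poly_eval p y = 0"
proof -
  have "S \<noteq> {}" using y by auto
  then obtain x where "x \<in> rel_interior S" using \<open>convex S\<close> rel_interior_eq_empty by blast
  then obtain e where e: "e > 0" "ball x e \<inter> affine hull S \<subseteq> S" and x: "x \<in> S"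
    by (auto simp: mem_rel_interior_ball)
  obtain q :: "real poly" where q: "\<And>t. poly q t = poly_eval p (x + t *\<^sub>R (y - x))"
    using poly_eval_line by blast
  \<comment> \<open>The summand 1 keeps the denominator positive when \<open>y = x\<close>.\<close>
  define \<delta> where "\<delta> = e / (norm (y - x) + 1)"
  have "\<delta> > 0" using e by (simp add: \<delta>_def add_nonneg_pos)
  have "poly q t = 0" if "t \<in> {0<..<\<delta>}" for t
  proof -
    have "t * (norm (y - x) + 1) < e"
      using that by (simp add: \<delta>_def pos_less_divide_eq add_nonneg_pos)
    then have "t * norm (y - x) < e" using that by (simp add: algebra_simps)
    then have "x + t *\<^sub>R (y - x) \<in> ball x e" using that by (simp add: dist_norm)
    moreover have "x + t *\<^sub>R (y - x) \<in> affine hull S"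
    proof -
      have "(1 - t) *\<^sub>R x + t *\<^sub>R y \<in> affine hull S"
        using y hull_inc[OF x, of affine] affine_affine_hull by (intro mem_affine) auto
      then show ?thesis by (simp add: algebra_simps)
    qed
    ultimately have "x + t *\<^sub>R (y - x) \<in> S" using e(2) by blast
    then show ?thesis by (simp add: q zero)
  qed
  then have "{0<..<\<delta>} \<subseteq> {t. poly q t = 0}" by auto
  then have "infinite {t. poly q t = 0}"
    using \<open>\<delta> > 0\<close> infinite_Ioo infinite_super by blast
  then have "q = 0" using poly_roots_finite by blast
  then show ?thesis using q[of 1] by simp
qed

lemma poly_eval_inject_convex:
  fixes S :: "(real ^ 'n::finite) set"
  assumes "convex S" "affine hull S = UNIV" "\<And>x. x \<in> S \<Longrightarrow> poly_eval p x = poly_eval q x"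
  shows "p = q"
proof -
  have "poly_eval (p - q) y = 0" for y
    by (rule poly_eval_zero_affine_hull[OF assms(1)]) (simp_all add: assms(2,3))
  then show ?thesis by (intro poly_eval_inject) simp
qed

section \<open>Directional derivatives as polynomials\<close>

lemma has_derivative_poly_eval_const:
  "(poly_eval (poly_const c) has_derivative (\<lambda>w. poly_eval (poly_const 0) x)) (at x)"
proof -
  have *: "poly_eval (poly_const c) = (\<lambda>x. c)" by auto
  show ?thesis unfolding * by simp
qed

lemma has_derivative_poly_eval_var:
  "(poly_eval (poly_var i) has_derivative (\<lambda>w. poly_eval (poly_const (w $ i)) x)) (at x)"
proof -
  have "poly_eval (poly_var i) = (\<lambda>x. x $ i)" by auto
  then show ?thesis
    using bounded_linear_imp_has_derivative[OF bounded_linear_vec_nth] by simp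
qed

lemma has_derivative_poly_eval_add:
  assumes "(poly_eval p has_derivative (\<lambda>w. poly_eval (D w) x)) (at x)"
    and "(poly_eval q has_derivative (\<lambda>w. poly_eval (E w) x)) (at x)"
  shows "(poly_eval (p + q) has_derivative (\<lambda>w. poly_eval (D w + E w) x)) (at x)"
proof -
  have "poly_eval (p + q) = (\<lambda>x. poly_eval p x + poly_eval q x)" by auto
  then show ?thesis using has_derivative_add[OF assms] by simp
qed

lemma has_derivative_poly_eval_mult:
  assumes "(poly_eval p has_derivative (\<lambda>w. poly_eval (D w) x)) (at x)"
    and "(poly_eval q has_derivative (\<lambda>w. poly_eval (E w) x)) (at x)"
  shows "(poly_eval (p * q) has_derivative (\<lambda>w. poly_eval (p * E w + D w * q) x)) (at x)"
proof -
  have "poly_eval (p * q) = (\<lambda>x. poly_eval p x * poly_eval q x)" by auto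
  then show ?thesis using has_derivative_mult[OF assms] by simp
qed

text \<open>\<open>D\<close> is chosen before \<open>x\<close>: in every direction the derivative is
  again a polynomial, which allows differentiation to be iterated inside R.\<close>

lemma poly_eval_has_derivative_ex:
  "\<exists>D. \<forall>x. (poly_eval p has_derivative (\<lambda>w. poly_eval (D w) x)) (at x)"
proof (induction p rule: mpoly_induct)
  case (const c)
  show ?case by (rule exI[of _ "\<lambda>w. poly_const 0"], rule allI, rule has_derivative_poly_eval_const)
next
  case (var i)
  show ?case by (rule exI[of _ "\<lambda>w. poly_const (w $ i)"], rule allI, rule has_derivative_poly_eval_var)
next
  case (add p q)
  then obtain D E where "\<And>x. (poly_eval p has_derivative (\<lambda>w. poly_eval (D w) x)) (at x)"
    "\<And>x. (poly_eval q has_derivative (\<lambda>w. poly_eval (E w) x)) (at x)"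
    by blast
  then show ?case
    by (intro exI[of _ "\<lambda>w. D w + E w"] allI has_derivative_poly_eval_add)
next
  case (mult p q)
  then obtain D E where "\<And>x. (poly_eval p has_derivative (\<lambda>w. poly_eval (D w) x)) (at x)"
    "\<And>x. (poly_eval q has_derivative (\<lambda>w. poly_eval (E w) x)) (at x)"
    by blast
  then show ?case
    by (intro exI[of _ "\<lambda>w. p * E w + D w * q"] allI has_derivative_poly_eval_mult)
qed

text \<open>The derivative is picked by existence rather than by a formula on coefficients.
  \<open>SOME\<close> ranges over whole families in \<open>w\<close>, so that all directions come
  from one Frechet derivative.\<close>

definition dir_deriv :: "real ^ 'n \<Rightarrow> 'n::finite mpoly \<Rightarrow> 'n mpoly" where
  "dir_deriv w p =
    (SOME D. \<forall>x. (poly_eval p has_derivative (\<lambda>w. poly_eval (D w) x)) (at x)) w"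

lemma poly_eval_has_derivative:
  "(poly_eval p has_derivative (\<lambda>w. poly_eval (dir_deriv w p) x)) (at x within S)"
  unfolding dir_deriv_def
  by (rule has_derivative_at_withinI) (rule someI_ex[OF poly_eval_has_derivative_ex, THEN spec])

text \<open>Frechet derivatives on the whole space are unique and polynomials are determined by
  their values, so the choice in \<open>dir_deriv\<close> is immaterial. The sum and product rules
  are read off from this.\<close>

lemma dir_deriv_eqI:
  assumes "\<And>x. (poly_eval p has_derivative (\<lambda>w. poly_eval (D w) x)) (at x)"
  shows "dir_deriv w p = D w"
proof (rule poly_eval_inject)
  fix x
  show "poly_eval (dir_deriv w p) x = poly_eval (D w) x"
    using fun_cong[OF has_derivative_unique[OF poly_eval_has_derivative[of p x UNIV] assms[of x]], of w] .
qed

lemma dir_deriv_add: "dir_deriv w (p + q) = dir_deriv w p + dir_deriv w q"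
  by (rule dir_deriv_eqI) (rule has_derivative_poly_eval_add[OF poly_eval_has_derivative poly_eval_has_derivative])

lemma dir_deriv_diff: "dir_deriv w (p - q) = dir_deriv w p - dir_deriv w q"
  using dir_deriv_add[of w "p - q" q] by simp

lemma dir_deriv_mult: "dir_deriv w (p * q) = p * dir_deriv w q + dir_deriv w p * q"
  by (rule dir_deriv_eqI) (rule has_derivative_poly_eval_mult[OF poly_eval_has_derivative poly_eval_has_derivative])

lemma dir_deriv_power_Suc:
  "dir_deriv w (p ^ Suc k) = of_nat (Suc k) * p ^ k * dir_deriv w p"
proof (induction k)
  case 0
  show ?case by simp
next
  case (Suc k)
  have "dir_deriv w (p ^ Suc (Suc k)) = p * dir_deriv w (p ^ Suc k) + dir_deriv w p * p ^ Suc k"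
    by (simp only: power_Suc[of p "Suc k"] dir_deriv_mult)
  also have "p * dir_deriv w (p ^ Suc k) = of_nat (Suc k) * (p ^ Suc k * dir_deriv w p)"
    unfolding Suc by (simp only: power_Suc mult_ac)
  also have "dir_deriv w p * p ^ Suc k = 1 * (p ^ Suc k * dir_deriv w p)"
    by (simp only: mult_1 mult.commute)
  also have "of_nat (Suc k) * (p ^ Suc k * dir_deriv w p) + 1 * (p ^ Suc k * dir_deriv w p)
      = of_nat (Suc (Suc k)) * p ^ Suc k * dir_deriv w p"
    by (simp only: of_nat_Suc[of "Suc k"] distrib_right add.commute mult.assoc)
  finally show ?case .
qed

section \<open>Divisibility by powers of a linear form\<close>

definition linear_poly :: "real ^ 'n \<Rightarrow> 'n::finite mpoly" where
  "linear_poly a = (\<Sum>i\<in>UNIV. poly_const (a $ i) * poly_var i)"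

lemma poly_eval_linear_poly [simp]: "poly_eval (linear_poly a) x = a \<bullet> x"
  by (simp add: linear_poly_def inner_vec_def)

lemma dir_deriv_linear_poly: "dir_deriv w (linear_poly a) = poly_const (a \<bullet> w)"
proof (rule dir_deriv_eqI)
  fix x
  have "poly_eval (linear_poly a) = (\<lambda>x. a \<bullet> x)" by auto
  then show "(poly_eval (linear_poly a) has_derivative (\<lambda>w. poly_eval (poly_const (a \<bullet> w)) x)) (at x)"
    using bounded_linear_imp_has_derivative[OF bounded_linear_inner_right] by simp
qed

text \<open>Projecting along a coordinate axis onto the hyperplane changes a polynomial only by
  multiples of the linear form, and the projected polynomial vanishes.\<close>

lemma linear_poly_dvd:
  fixes a :: "real ^ 'n::finite"
  assumes "a \<noteq> 0" and zero: "\<And>x. a \<bullet> x = 0 \<Longrightarrow> poly_eval p x = 0"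
  shows "linear_poly a dvd p"
proof -
  obtain i where i: "a $ i \<noteq> 0" using \<open>a \<noteq> 0\<close> by (auto simp: vec_eq_iff)
  define T where "T x = x - ((a \<bullet> x) / a $ i) *\<^sub>R axis i 1" for x
  have "\<exists>q. linear_poly a dvd p - q \<and> (\<forall>x. poly_eval q x = poly_eval p (T x))" for p
  proof (induction p rule: mpoly_induct)
    case (const c)
    show ?case by (intro exI[of _ "poly_const c"]) simp
  next
    case (var j)
    let ?q = "poly_var j - linear_poly a * poly_const (axis i 1 $ j / a $ i)"
    have "linear_poly a dvd poly_var j - ?q" by simp
    moreover have "poly_eval ?q x = poly_eval (poly_var j) (T x)" for x
      by (simp add: T_def)
    ultimately show ?case by blast
  next
    case (add p q)
    then obtain p' q' where "linear_poly a dvd p - p'" "linear_poly a dvd q - q'"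
      and *: "\<forall>x. poly_eval p' x = poly_eval p (T x)" "\<forall>x. poly_eval q' x = poly_eval q (T x)"
      by blast
    then have "linear_poly a dvd (p - p') + (q - q')" by (intro dvd_add)
    then have "linear_poly a dvd (p + q) - (p' + q')" by (simp add: algebra_simps)
    with * show ?case by (metis poly_eval_add)
  next
    case (mult p q)
    then obtain p' q' where "linear_poly a dvd p - p'" "linear_poly a dvd q - q'"
      and *: "\<forall>x. poly_eval p' x = poly_eval p (T x)" "\<forall>x. poly_eval q' x = poly_eval q (T x)"
      by blast
    then have "linear_poly a dvd (p - p') * q + p' * (q - q')" by (intro dvd_add) auto
    then have "linear_poly a dvd p * q - p' * q'" by (simp add: algebra_simps)
    with * show ?case by (metis poly_eval_mult)
  qed
  then obtain q where q: "linear_poly a dvd p - q" "\<And>x. poly_eval q x = poly_eval p (T x)"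
    by blast
  have "a \<bullet> T x = 0" for x
    using i by (simp add: T_def inner_diff_right inner_axis)
  then have "q = 0" using q(2) zero by (intro poly_eval_inject) simp
  with q(1) show ?thesis by simp
qed

text \<open>On the open half-space where the form is positive its powers cancel pointwise, and this
  half-space is large enough to determine a polynomial.\<close>

lemma linear_poly_mult_cancel:
  fixes a :: "real ^ 'n::finite"
  assumes "a \<noteq> 0" "linear_poly a ^ k * p = linear_poly a ^ k * q"
  shows "p = q"
proof (rule poly_eval_inject_convex)
  let ?H = "{x. a \<bullet> x > 0}"
  show "convex ?H" by (rule convex_halfspace_gt)
  have "a \<in> ?H" using \<open>a \<noteq> 0\<close> by simp
  then show "affine hull ?H = UNIV"
    using affine_hull_open[OF open_halfspace_gt] by blast
  show "poly_eval p x = poly_eval q x" if "x \<in> ?H" for x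
    using arg_cong[OF assms(2), of "\<lambda>p. poly_eval p x"] that by simp
qed

text \<open>Differentiation along the normal vector \<open>a\<close> turns
  \<open>l ^ (j + 1) * h\<close> into \<open>l ^ (j + 1)\<close> times the derivative of
  \<open>h\<close> plus \<open>(j + 1) * (a \<bullet> a) * l ^ j * h\<close>. If the result is
  divisible by \<open>l ^ (j + 1)\<close>, then cancelling \<open>l ^ j\<close> shows that
  \<open>l\<close> divides \<open>h\<close>, since \<open>(j + 1) * (a \<bullet> a)\<close> is a
  nonzero real. So the multiplicity climbs from 1 to \<open>k + 1\<close>.\<close>

lemma linear_poly_power_dvd_if_dir_deriv:
  fixes a :: "real ^ 'n::finite"
  assumes "a \<noteq> 0" and dvd: "linear_poly a dvd g"
    and D: "\<And>w. linear_poly a ^ k dvd dir_deriv w g"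
  shows "linear_poly a ^ Suc k dvd g"
proof -
  have "linear_poly a ^ Suc j dvd g" if "j \<le> k" for j
    using that
  proof (induction j)
    case 0
    then show ?case using dvd by simp
  next
    case (Suc j)
    let ?l = "linear_poly a"
    obtain h where h: "g = ?l ^ Suc j * h" using Suc by (auto elim: dvdE)
    obtain h' where h': "dir_deriv a g = ?l ^ Suc j * h'"
      using D[of a] power_le_dvd[of ?l k _ "Suc j"] Suc.prems by (auto elim: dvdE)
    \<comment> \<open>\<open>c\<close> is the constant factor produced by the derivative and
      \<open>d\<close> its inverse, so that \<open>h\<close> can be recovered from
      \<open>c * h\<close>.\<close>
    define c where "c = (poly_const (of_nat (Suc j) * (a \<bullet> a)) :: 'n mpoly)"
    define d where "d = (poly_const (inverse (of_nat (Suc j) * (a \<bullet> a))) :: 'n mpoly)"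
    have c: "of_nat (Suc j) * poly_const (a \<bullet> a) = c"
      by (intro poly_eval_inject) (simp add: c_def del: of_nat_Suc)
    have "of_nat (Suc j) * ?l ^ j * poly_const (a \<bullet> a) * h = ?l ^ j * (c * h)"
      unfolding c[symmetric] by (simp only: mult_ac)
    then have "dir_deriv a g = ?l ^ Suc j * dir_deriv a h + ?l ^ j * (c * h)"
      unfolding h dir_deriv_mult dir_deriv_power_Suc dir_deriv_linear_poly by simp
    then have "?l ^ j * (c * h) = ?l ^ j * (?l * (h' - dir_deriv a h))"
      unfolding h' by (simp add: right_diff_distrib mult.assoc mult.left_commute)
    then have ch: "c * h = ?l * (h' - dir_deriv a h)"
      using linear_poly_mult_cancel[OF \<open>a \<noteq> 0\<close>] by blast
    have nz: "of_nat (Suc j) * (a \<bullet> a) \<noteq> 0" using \<open>a \<noteq> 0\<close> by (simp del: of_nat_Suc)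
    have "d * c = 1"
      by (intro poly_eval_inject)
        (simp only: c_def d_def poly_eval_mult poly_eval_const poly_eval_1 left_inverse[OF nz])
    then have "h = d * (c * h)" by (simp only: mult_1 flip: mult.assoc)
    also have "\<dots> = ?l * (d * (h' - dir_deriv a h))"
      unfolding ch by (rule mult.left_commute)
    finally have "h = ?l * (d * (h' - dir_deriv a h))" .
    then have "?l dvd h" by (rule dvdI)
    then show ?case unfolding h power_Suc2[of _ "Suc j"] by (rule mult_dvd_mono[OF dvd_refl])
  qed
  then show ?thesis by simp
qed

section \<open>Gluing polynomials to differentiable functions\<close>

lemma continuous_on_poly_eval: "continuous_on S (poly_eval p)"
  by (rule has_derivative_continuous_on) (rule poly_eval_has_derivative)

lemma Ck_on_imp_continuous_on:
  assumes "Ck_on k S f"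
  shows "continuous_on S f"
proof (cases k)
  case (Suc j)
  then obtain f' where "\<And>x. x \<in> S \<Longrightarrow> (f has_derivative f' x) (at x within S)"
    using assms by auto
  then show ?thesis by (rule has_derivative_continuous_on)
qed (use assms in simp)

lemma has_derivative_eq_dir_deriv:
  fixes u :: "(real ^ 'n::finite) set"
  assumes f': "\<And>x. x \<in> S \<Longrightarrow> (f has_derivative f' x) (at x within S)"
    and cont: "continuous_on S (\<lambda>x. f' x w)"
    and u: "u \<subseteq> S" "closed u" "convex u" "interior u \<noteq> {}"
    and p: "\<And>x. x \<in> u \<Longrightarrow> f x = poly_eval p x"
    and x: "x \<in> u"
  shows "f' x w = poly_eval (dir_deriv w p) x"
proof -
  define g where "g x = f' x w - poly_eval (dir_deriv w p) x" for x
  have "g y = 0" if y: "y \<in> interior u" for y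
  proof -
    have "y \<in> u" using y interior_subset by auto
    then have "(f has_derivative f' y) (at y within u)"
      using f' u(1) has_derivative_subset by blast
    then have "(poly_eval p has_derivative f' y) (at y within u)"
      using has_derivative_transform[of y u "poly_eval p" f] p \<open>y \<in> u\<close> by simp
    then have "(poly_eval p has_derivative f' y) (at y)"
      by (simp add: at_within_interior[OF y])
    from fun_cong[OF has_derivative_unique[OF this poly_eval_has_derivative[of p y UNIV]], of w]
    show ?thesis by (simp add: g_def)
  qed
  then have "interior u \<subseteq> {y\<in>u. g y = 0}" using interior_subset by auto
  moreover have "closed {y\<in>u. g y = 0}"
  proof (rule continuous_closed_preimage_constant[OF _ \<open>closed u\<close>])
    show "continuous_on u g"
      unfolding g_def
      by (intro continuous_on_diff continuous_on_subset[OF cont u(1)] continuous_on_poly_eval)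
  qed
  ultimately have "closure (interior u) \<subseteq> {y\<in>u. g y = 0}" by (rule closure_minimal)
  moreover have "closure (interior u) = u"
    using convex_closure_interior[OF u(3,4)] closure_closed[OF u(2)] by simp
  ultimately show ?thesis using x by (auto simp: g_def)
qed

text \<open>Induction on the order with \<open>f\<close>, \<open>p\<close>, \<open>q\<close>
  generalised: the derivative of \<open>f\<close> in a direction \<open>w\<close> is smooth of one
  order less and has the pieces \<open>dir_deriv w p\<close> and \<open>dir_deriv w q\<close>, so
  the induction hypothesis supplies what \<open>linear_poly_power_dvd_if_dir_deriv\<close> asks for.
  Divisibility by the form itself comes from the common set \<open>u \<inter> v\<close>, whose
  affine hull contains the hyperplane.\<close>

lemma Ck_on_pieces_dvd:
  fixes u v :: "(real ^ 'n::finite) set"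
  assumes "Ck_on k S f" "u \<subseteq> S" "v \<subseteq> S"
    and u: "closed u" "convex u" "interior u \<noteq> {}"
    and v: "closed v" "convex v" "interior v \<noteq> {}"
    and "\<And>x. x \<in> u \<Longrightarrow> f x = poly_eval p x" "\<And>x. x \<in> v \<Longrightarrow> f x = poly_eval q x"
    and a: "a \<noteq> 0" "{x. a \<bullet> x = 0} \<subseteq> affine hull (u \<inter> v)"
  shows "linear_poly a ^ Suc k dvd p - q"
  using assms(1,10,11)
proof (induction k arbitrary: f p q)
  case 0
  have "poly_eval (p - q) x = 0" if "x \<in> u \<inter> v" for x
    using 0(2,3)[of x] that by simp
  then have "poly_eval (p - q) x = 0" if "a \<bullet> x = 0" for x
    using poly_eval_zero_affine_hull[of "u \<inter> v"] convex_Int[OF u(2) v(2)] a(2) that by blast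
  then show ?case using linear_poly_dvd[OF a(1)] by simp
next
  case (Suc k)
  obtain f' where f': "\<And>x. x \<in> S \<Longrightarrow> (f has_derivative f' x) (at x within S)"
    and Ck: "\<And>w. Ck_on k S (\<lambda>x. f' x w)"
    using Suc.prems(1) by auto
  have cont: "continuous_on S (\<lambda>x. f' x w)" for w by (rule Ck_on_imp_continuous_on[OF Ck])
  show ?case
  proof (rule linear_poly_power_dvd_if_dir_deriv[OF a(1)])
    have "poly_eval (p - q) x = 0" if "x \<in> u \<inter> v" for x
      using Suc.prems(2,3)[of x] that by simp
    then have "poly_eval (p - q) x = 0" if "a \<bullet> x = 0" for x
      using poly_eval_zero_affine_hull[of "u \<inter> v"] convex_Int[OF u(2) v(2)] a(2) that by blast
    then show "linear_poly a dvd p - q" by (rule linear_poly_dvd[OF a(1)])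
  next
    fix w
    have "linear_poly a ^ Suc k dvd dir_deriv w p - dir_deriv w q"
    proof (rule Suc.IH[OF Ck])
      show "f' x w = poly_eval (dir_deriv w p) x" if "x \<in> u" for x
        by (rule has_derivative_eq_dir_deriv[OF f' cont assms(2) u Suc.prems(2) that])
      show "f' x w = poly_eval (dir_deriv w q) x" if "x \<in> v" for x
        by (rule has_derivative_eq_dir_deriv[OF f' cont assms(3) v Suc.prems(3) that])
    qed
    then show "linear_poly a ^ Suc k dvd dir_deriv w (p - q)" by (simp only: dir_deriv_diff)
  qed
qed

section \<open>Jets and gluing over finitely many closed sets\<close>

text \<open>Equality of \<open>k\<close>-jets at \<open>x\<close>. The recursion copies that of
  \<open>Ck_on\<close>, so that gluing can proceed by the same induction.\<close>

primrec jet_eq :: "nat \<Rightarrow> 'n::finite mpoly \<Rightarrow> 'n mpoly \<Rightarrow> real ^ 'n \<Rightarrow> bool" where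
  "jet_eq 0 p q x \<longleftrightarrow> poly_eval p x = poly_eval q x"
| "jet_eq (Suc k) p q x \<longleftrightarrow>
     poly_eval p x = poly_eval q x \<and> (\<forall>w. jet_eq k (dir_deriv w p) (dir_deriv w q) x)"

lemma jet_eq_refl: "jet_eq k p p x"
  by (induction k arbitrary: p) auto

lemma jet_eq_trans: "jet_eq k p q x \<Longrightarrow> jet_eq k q s x \<Longrightarrow> jet_eq k p s x"
  by (induction k arbitrary: p q s) (simp, metis jet_eq.simps(2))

lemma jet_eq_imp_eval_eq: "jet_eq k p q x \<Longrightarrow> poly_eval p x = poly_eval q x"
  by (cases k) auto

text \<open>Each differentiation uses up at most one factor of the form, so after \<open>k\<close>
  of them one of the \<open>k + 1\<close> factors, vanishing at \<open>x\<close>, is still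
  left.\<close>

lemma jet_eq_if_power_dvd:
  assumes "linear_poly a ^ Suc k dvd p - q" "a \<bullet> x = 0"
  shows "jet_eq k p q x"
  using assms(1)
proof (induction k arbitrary: p q)
  case 0
  then obtain h where "p - q = linear_poly a * h" by (auto elim: dvdE)
  from arg_cong[OF this, of "\<lambda>p. poly_eval p x"] assms(2) show ?case by simp
next
  case (Suc k)
  then obtain h where h: "p - q = linear_poly a ^ Suc (Suc k) * h" by (auto elim: dvdE)
  from arg_cong[OF this, of "\<lambda>p. poly_eval p x"] assms(2) have "poly_eval p x = poly_eval q x"
    by simp
  moreover have "linear_poly a ^ Suc k dvd dir_deriv w p - dir_deriv w q" for w
  proof -
    have "dir_deriv w p - dir_deriv w q = dir_deriv w (linear_poly a ^ Suc (Suc k) * h)"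
      unfolding h[symmetric] by (rule dir_deriv_diff[symmetric])
    also have "\<dots> = linear_poly a ^ Suc k * (linear_poly a * dir_deriv w h
        + of_nat (Suc (Suc k)) * dir_deriv w (linear_poly a) * h)"
      unfolding dir_deriv_mult[of w "linear_poly a ^ Suc (Suc k)" h] dir_deriv_power_Suc[of w _ "Suc k"]
      by (simp only: power_Suc distrib_left mult_ac)
    finally show ?thesis by (rule dvdI)
  qed
  ultimately show ?case using Suc.IH by simp
qed

text \<open>For finitely many sets the filter within the union is the supremum of the filters within
  the members, and a closed member that misses \<open>x\<close> contributes the trivial
  filter.\<close>

lemma has_derivative_within_Union:
  assumes "finite V" "bounded_linear F"
    and "\<And>v. v \<in> V \<Longrightarrow> closed v"
    and "\<And>v. v \<in> V \<Longrightarrow> x \<in> v \<Longrightarrow> (f has_derivative F) (at x within v)"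
  shows "(f has_derivative F) (at x within \<Union>V)"
proof -
  let ?g = "\<lambda>y. norm ((f y - f x) - F (y - x)) / norm (y - x)"
  have "(?g \<longlongrightarrow> 0) (at x within \<Union>V)"
    using assms(1,3,4)
  proof (induction V rule: finite_induct)
    case empty
    then show ?case by simp
  next
    case (insert v V)
    have "(?g \<longlongrightarrow> 0) (at x within v)"
    proof (cases "x \<in> v")
      case True
      then show ?thesis using insert.prems(2)[of v] by (simp add: has_derivative_iff_norm)
    next
      case False
      then have "x \<notin> closure v" using insert.prems(1)[of v] by simp
      then have "at x within v = bot" by (rule not_in_closure_trivial_limitI)
      then show ?thesis by simp
    qed
    moreover have "(?g \<longlongrightarrow> 0) (at x within \<Union>V)"
      by (rule insert.IH) (use insert.prems in auto)
    ultimately show ?case by (simp add: at_within_union filterlim_sup)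
  qed
  then show ?thesis using assms(2) by (simp add: has_derivative_iff_norm)
qed

text \<open>The derivative at \<open>x\<close> is read off from an arbitrary member
  \<open>s x\<close> containing \<open>x\<close>; equality of jets makes the choice irrelevant. It
  is therefore itself glued from the polynomials \<open>dir_deriv w (P v)\<close>, whose jets agree
  to one order less, and the induction continues.\<close>

lemma Ck_on_glue:
  fixes V :: "(real ^ 'n::finite) set set"
  assumes "finite V" "\<And>v. v \<in> V \<Longrightarrow> closed v"
    and "\<And>v x. v \<in> V \<Longrightarrow> x \<in> v \<Longrightarrow> f x = poly_eval (P v) x"
    and "\<And>u v x. u \<in> V \<Longrightarrow> v \<in> V \<Longrightarrow> x \<in> u \<Longrightarrow> x \<in> v \<Longrightarrow> jet_eq k (P u) (P v) x"
  shows "Ck_on k (\<Union>V) f"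
  using assms(3,4)
proof (induction k arbitrary: f P)
  case 0
  have "continuous_on (\<Union>v\<in>V. v) f"
  proof (rule continuous_on_closed_Union[OF assms(1,2)])
    fix v assume "v \<in> V"
    then show "continuous_on v f"
      using continuous_on_poly_eval[of v "P v"] 0(1) continuous_on_cong by metis
  qed
  then show ?case by simp
next
  case (Suc k)
  define s where "s x = (SOME v. v \<in> V \<and> x \<in> v)" for x
  have s: "s x \<in> V" "x \<in> s x" if "x \<in> \<Union>V" for x
  proof -
    have "\<exists>v. v \<in> V \<and> x \<in> v" using that by auto
    then have "s x \<in> V \<and> x \<in> s x" unfolding s_def by (rule someI_ex)
    then show "s x \<in> V" "x \<in> s x" by auto
  qed
  define f' where "f' x w = poly_eval (dir_deriv w (P (s x))) x" for x w
  have f': "f' x w = poly_eval (dir_deriv w (P v)) x" if v: "v \<in> V" "x \<in> v" for v x w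
  proof -
    have "x \<in> \<Union>V" using v by auto
    then have "jet_eq (Suc k) (P (s x)) (P v) x" using Suc.prems(2) s v by blast
    then have "jet_eq k (dir_deriv w (P (s x))) (dir_deriv w (P v)) x" by simp
    then show ?thesis unfolding f'_def by (rule jet_eq_imp_eval_eq)
  qed
  have "(f has_derivative f' x) (at x within \<Union>V)" if x: "x \<in> \<Union>V" for x
  proof (rule has_derivative_within_Union[OF assms(1)])
    show "bounded_linear (f' x)"
      unfolding f'_def using poly_eval_has_derivative[of "P (s x)" x UNIV]
      by (rule has_derivative_bounded_linear)
    show "closed v" if "v \<in> V" for v using assms(2) that .
    show "(f has_derivative f' x) (at x within v)" if v: "v \<in> V" "x \<in> v" for v
    proof -
      have "f' x = (\<lambda>w. poly_eval (dir_deriv w (P v)) x)" using f'[OF v] by blast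
      then show ?thesis
        using has_derivative_transform[OF v(2) Suc.prems(1)[OF v(1)] poly_eval_has_derivative] by simp
    qed
  qed
  moreover have "Ck_on k (\<Union>V) (\<lambda>x. f' x w)" for w
  proof (rule Suc.IH)
    show "f' x w = poly_eval (dir_deriv w (P v)) x" if "v \<in> V" "x \<in> v" for v x
      using f' that .
    show "jet_eq k (dir_deriv w (P u)) (dir_deriv w (P v)) x"
      if "u \<in> V" "v \<in> V" "x \<in> u" "x \<in> v" for u v x
      using Suc.prems(2)[OF that] by simp
  qed
  ultimately show ?case by auto
qed

section \<open>Linear operations on functions of class C^k\<close>

lemma Ck_on_add: "Ck_on k S f \<Longrightarrow> Ck_on k S g \<Longrightarrow> Ck_on k S (\<lambda>x. f x + g x)"
proof (induction k arbitrary: f g)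
  case 0
  then show ?case by (simp add: continuous_on_add)
next
  case (Suc k)
  then obtain f' g' where "\<forall>x\<in>S. (f has_derivative f' x) (at x within S)" "\<And>w. Ck_on k S (\<lambda>x. f' x w)"
    "\<forall>x\<in>S. (g has_derivative g' x) (at x within S)" "\<And>w. Ck_on k S (\<lambda>x. g' x w)"
    by auto
  then show ?case
    unfolding Ck_on.simps
    by (intro exI[of _ "\<lambda>x w. f' x w + g' x w"] conjI ballI allI has_derivative_add Suc.IH) auto
qed

lemma Ck_on_mult_const: "Ck_on k S f \<Longrightarrow> Ck_on k S (\<lambda>x. c * f x)"
  for c :: real
proof (induction k arbitrary: f)
  case 0
  then show ?case by (simp add: continuous_on_mult_left)
next
  case (Suc k)
  then obtain f' where "\<forall>x\<in>S. (f has_derivative f' x) (at x within S)" "\<And>w. Ck_on k S (\<lambda>x. f' x w)"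
    by auto
  then show ?case
    unfolding Ck_on.simps
    by (intro exI[of _ "\<lambda>x w. c * f' x w"] conjI ballI allI has_derivative_mult_right Suc.IH) auto
qed

lemma Ck_on_cong:
  assumes "\<And>x. x \<in> S \<Longrightarrow> f x = g x"
  shows "Ck_on k S f \<longleftrightarrow> Ck_on k S g"
proof (cases k)
  case 0
  then show ?thesis using assms by (simp cong: continuous_on_cong)
next
  case (Suc j)
  have "(f has_derivative F) (at x within S) \<longleftrightarrow> (g has_derivative F) (at x within S)"
    if "x \<in> S" for x F
    using has_derivative_transform[OF that, of f g F] has_derivative_transform[OF that, of g f F] assms
    by auto
  then show ?thesis using Suc by (auto simp del: ex_simps)
qed

lemma Ck_on_const: "Ck_on k S (\<lambda>x. c)"
  for c :: real
proof (induction k arbitrary: c)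
  case (Suc k)
  then show ?case by (auto intro!: exI[of _ "\<lambda>x w. 0"])
qed simp

section \<open>Degree truncation\<close>

lemma mono_degree_0 [simp]: "mono_degree 0 = 0"
  by (simp add: mono_degree_def)

lemma mono_degree_add: "mono_degree (m + m') = mono_degree m + mono_degree m'"
  by (simp add: mono_degree_def lookup_add sum.distrib)

lemma mono_degree_single [simp]: "mono_degree (Poly_Mapping.single i k) = k"
  by (simp add: mono_degree_def lookup_single when_def)

lemma mono_degree_eq_0_iff: "mono_degree m = 0 \<longleftrightarrow> m = 0"
  by (auto simp: mono_degree_def poly_mapping_eq_iff fun_eq_iff)

lemma mono_degree_pos_obtains:
  assumes "0 < mono_degree m"
  obtains i where "Poly_Mapping.lookup m i \<noteq> 0"
  using assms unfolding mono_degree_def by (metis less_irrefl sum.neutral)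

lemma mono_degree_Suc_split:
  assumes "0 < mono_degree m"
  obtains i m' where "m = Poly_Mapping.single i 1 + m'"
proof -
  obtain i where i: "Poly_Mapping.lookup m i \<noteq> 0"
    using assms by (rule mono_degree_pos_obtains)
  have "m = Poly_Mapping.single i 1 + (m - Poly_Mapping.single i 1)"
    using i by (intro poly_mapping_eqI) (auto simp: lookup_add lookup_minus lookup_single when_def)
  then show thesis by (rule that)
qed

lemma mono_degree_split:
  assumes "k \<le> mono_degree m"
  shows "\<exists>m1 m2. m = m1 + m2 \<and> mono_degree m1 = k"
  using assms
proof (induction k)
  case 0
  then show ?case by (intro exI[of _ 0] exI[of _ m]) simp
next
  case (Suc k)
  then obtain m1 m2 where m: "m = m1 + m2" "mono_degree m1 = k" by auto
  then have "0 < mono_degree m2" using Suc.prems by (simp add: mono_degree_add)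
  then obtain i m' where "m2 = Poly_Mapping.single i 1 + m'" by (rule mono_degree_Suc_split)
  then show ?case using m
    by (intro exI[of _ "m1 + Poly_Mapping.single i 1"] exI[of _ m'])
      (simp add: mono_degree_add add.assoc)
qed

text \<open>Vanishing to order \<open>k\<close> at the origin, i.e. membership in the
  \<open>k\<close>-th power of the ideal generated by the variables. The zero polynomial counts for
  every \<open>k\<close>.\<close>

definition order_ge :: "nat \<Rightarrow> 'n::finite mpoly \<Rightarrow> bool" where
  "order_ge k p \<longleftrightarrow> (\<forall>m\<in>Poly_Mapping.keys p. k \<le> mono_degree m)"

lemma degree_le_add: "degree_le d p \<Longrightarrow> degree_le d q \<Longrightarrow> degree_le d (p + q)"
  using keys_add[of p q] by (auto simp: degree_le_def)

lemma degree_le_diff: "degree_le d p \<Longrightarrow> degree_le d q \<Longrightarrow> degree_le d (p - q)"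
  using keys_diff[of p q] by (auto simp: degree_le_def)

lemma degree_le_mult: "degree_le d p \<Longrightarrow> degree_le e q \<Longrightarrow> degree_le (d + e) (p * q)"
  using keys_mult[of p q] by (fastforce simp: degree_le_def mono_degree_add add_mono)

lemma degree_le_const [simp]: "degree_le d (poly_const c)"
  by (simp add: degree_le_def poly_const_def)

lemma order_ge_0 [simp]: "order_ge k 0" "order_ge 0 p"
  by (auto simp: order_ge_def)

lemma order_ge_add: "order_ge d p \<Longrightarrow> order_ge d q \<Longrightarrow> order_ge d (p + q)"
  using keys_add[of p q] by (auto simp: order_ge_def)

lemma order_ge_diff: "order_ge d p \<Longrightarrow> order_ge d q \<Longrightarrow> order_ge d (p - q)"
  using keys_diff[of p q] by (auto simp: order_ge_def)

lemma order_ge_mult: "order_ge d p \<Longrightarrow> order_ge e q \<Longrightarrow> order_ge (d + e) (p * q)"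
  using keys_mult[of p q] by (fastforce simp: order_ge_def mono_degree_add add_mono)

lemma order_ge_mult_left: "order_ge e q \<Longrightarrow> order_ge e (p * q)"
  using order_ge_mult[of 0 p e q] by simp

lemma order_ge_mono: "order_ge d p \<Longrightarrow> e \<le> d \<Longrightarrow> order_ge e p"
  by (auto simp: order_ge_def)

text \<open>Together with \<open>degree_order_decompose\<close> this says that every class modulo
  order above \<open>d\<close> has exactly one representative of degree at most \<open>d\<close>:
  the algebraic source of injectivity and surjectivity of \<open>phi\<close>.\<close>

lemma degree_order_disjoint: "degree_le d p \<Longrightarrow> order_ge (Suc d) p \<Longrightarrow> p = 0"
  by (metis Suc_n_not_le_n degree_le_def ex_in_conv keys_eq_empty order_ge_def order_trans)

lemma degree_order_decompose:
  "\<exists>a b. p = a + b \<and> degree_le d a \<and> order_ge (Suc d) b"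
proof (induction p rule: poly_mapping_induct)
  case (single m c)
  show ?case
  proof (cases "mono_degree m \<le> d")
    case True
    then show ?thesis
      by (intro exI[of _ "Poly_Mapping.single m c"] exI[of _ 0]) (simp add: degree_le_def)
  next
    case False
    then show ?thesis
      by (intro exI[of _ 0] exI[of _ "Poly_Mapping.single m c"])
        (simp add: order_ge_def degree_le_def)
  qed
next
  case (add p q)
  then obtain a b a' b' where "p = a + b" "degree_le d a" "order_ge (Suc d) b"
    "q = a' + b'" "degree_le d a'" "order_ge (Suc d) b'" by blast
  then show ?case
    by (intro exI[of _ "a + a'"] exI[of _ "b + b'"])
      (simp add: degree_le_add order_ge_add algebra_simps)
qed

lemma order_ge_1_eval_0:
  assumes "order_ge 1 p"
  shows "poly_eval p 0 = 0"
  unfolding poly_eval_def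
proof (rule sum.neutral, rule ballI)
  fix m assume "m \<in> Poly_Mapping.keys p"
  then have "0 < mono_degree m" using assms by (auto simp: order_ge_def)
  then obtain i where "Poly_Mapping.lookup m i \<noteq> 0" by (rule mono_degree_pos_obtains)
  then have "(\<Prod>i\<in>UNIV. ((0::real ^ 'a) $ i) ^ Poly_Mapping.lookup m i) = 0"
    by (intro prod_zero) auto
  then show "Poly_Mapping.lookup p m * (\<Prod>i\<in>UNIV. ((0::real ^ 'a) $ i) ^ Poly_Mapping.lookup m i) = 0"
    by simp
qed

lemma degree_le_0_eval:
  assumes "degree_le 0 p"
  shows "poly_eval p x = poly_eval p y"
  unfolding poly_eval_def
  using assms by (intro sum.cong) (auto simp: degree_le_def mono_degree_eq_0_iff)

lemma linear_poly_add: "linear_poly (a + b) = linear_poly a + linear_poly b"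
  by (rule poly_eval_inject) (simp add: inner_add_left)

lemma poly_const_add: "poly_const (a + b) = poly_const a + poly_const b"
  by (simp add: poly_const_def single_add)

lemma degree_le_1_cases:
  assumes "degree_le 1 p"
  shows "\<exists>a c. p = linear_poly a + poly_const c"
  using assms
\<comment> \<open>Insertion of a fresh monomial cannot cancel anything, so the degree bound passes
  to the smaller polynomial; for arbitrary sums it would not.\<close>
proof (induction p rule: Poly_Mapping.update_induct)
  case const
  then show ?case by (intro exI[of _ 0] poly_eval_inject) simp
next
  case (update f m b)
  have keys: "Poly_Mapping.keys (Poly_Mapping.update m b f) = insert m (Poly_Mapping.keys f)"
    using update.hyps by (simp add: keys_update)
  then obtain a c where f: "f = linear_poly a + poly_const c"
    using update.IH update.prems by (auto simp: degree_le_def)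
  have eq: "Poly_Mapping.update m b f = f + Poly_Mapping.single m b"
    by (rule update_eq_add_single[OF update.hyps(1)])
  have "mono_degree m \<le> 1" using update.prems keys by (auto simp: degree_le_def)
  show ?case
  proof (cases "m = 0")
    case True
    then have "Poly_Mapping.update m b f = linear_poly a + poly_const (c + b)"
      by (subst eq) (simp add: f poly_const_add poly_const_def single_add add.assoc)
    then show ?thesis by blast
  next
    case False
    then have "0 < mono_degree m" using mono_degree_eq_0_iff by auto
    then obtain i m' where m: "m = Poly_Mapping.single i 1 + m'" by (rule mono_degree_Suc_split)
    then have "m' = 0" using \<open>mono_degree m \<le> 1\<close> by (simp add: mono_degree_add mono_degree_eq_0_iff)
    then have "Poly_Mapping.single m b = poly_const b * poly_var i"
      using m by (simp add: poly_const_def poly_var_def mult_single)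
    also have "\<dots> = linear_poly (axis i b)"
      by (rule poly_eval_inject) (simp add: inner_axis')
    finally have "Poly_Mapping.update m b f = linear_poly (a + axis i b) + poly_const c"
      by (subst eq) (simp add: f linear_poly_add add_ac)
    then show ?thesis by blast
  qed
qed

lemma degree_le_var: "degree_le 1 (poly_var i)" and order_ge_var: "order_ge 1 (poly_var i)"
  by (simp_all add: poly_var_def degree_le_def order_ge_def)

lemma degree_le_linear_poly: "degree_le 1 (linear_poly a)"
proof -
  have "degree_le 1 (\<Sum>i\<in>A. poly_const (a $ i) * poly_var i)" for A
    by (induction A rule: infinite_finite_induct)
      (use degree_le_mult[OF degree_le_const[of 0] degree_le_var] in
        \<open>auto intro: degree_le_add simp: degree_le_def[of _ 0]\<close>)
  then show ?thesis unfolding linear_poly_def .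
qed

lemma order_ge_linear_poly: "order_ge 1 (linear_poly a)"
proof -
  have "order_ge 1 (\<Sum>i\<in>A. poly_const (a $ i) * poly_var i)" for A
    by (induction A rule: infinite_finite_induct)
      (simp_all add: order_ge_add order_ge_mult_left order_ge_var del: One_nat_def)
  then show ?thesis unfolding linear_poly_def .
qed

lemma degree_le_linear_poly_power: "degree_le k (linear_poly a ^ k)"
proof (induction k)
  case 0
  show ?case using degree_le_const[of 0 1] by (simp add: poly_const_def)
next
  case (Suc k)
  then show ?case using degree_le_mult[OF degree_le_linear_poly[of a]] by fastforce
qed

lemma order_ge_linear_poly_power: "order_ge k (linear_poly a ^ k)"
proof (induction k)
  case (Suc k)
  then show ?case using order_ge_mult[OF order_ge_linear_poly[of a]] by fastforce
qed simp

text \<open>Split the cofactor \<open>h\<close> at degree \<open>d - k\<close>. As the power of the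
  form is homogeneous of degree \<open>k\<close>, the low part contributes only degree at most
  \<open>d\<close> and the high part only order above \<open>d\<close>; hence \<open>p\<close> minus
  the low contribution has both properties and is 0.\<close>

lemma linear_poly_power_dvd_modulo_order:
  assumes p: "degree_le d p" and h: "order_ge (Suc d) (p - linear_poly a ^ k * h)"
  shows "linear_poly a ^ k dvd p"
proof (cases "k \<le> d")
  case True
  obtain h1 h2 where h12: "h = h1 + h2" "degree_le (d - k) h1" "order_ge (Suc (d - k)) h2"
    using degree_order_decompose by blast
  have "degree_le d (linear_poly a ^ k * h1)"
    using degree_le_mult[OF degree_le_linear_poly_power[of k a] h12(2)] True by simp
  then have "degree_le d (p - linear_poly a ^ k * h1)" using p by (rule degree_le_diff[rotated])
  moreover have "order_ge (Suc d) (linear_poly a ^ k * h2)"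
    using order_ge_mult[OF order_ge_linear_poly_power[of k a] h12(3)] True by simp
  then have "order_ge (Suc d) (p - linear_poly a ^ k * h + linear_poly a ^ k * h2)"
    using h by (rule order_ge_add[rotated])
  then have "order_ge (Suc d) (p - linear_poly a ^ k * h1)" by (simp add: h12(1) algebra_simps)
  ultimately have "p - linear_poly a ^ k * h1 = 0" by (rule degree_order_disjoint)
  then have "p = linear_poly a ^ k * h1" by simp
  then show ?thesis by (rule dvdI)
next
  case False
  \<comment> \<open>For \<open>k > d\<close> the product with \<open>h\<close> is invisible modulo
    order above \<open>d\<close>, which forces \<open>p = 0\<close>.\<close>
  then have "order_ge (Suc d) (h * linear_poly a ^ k)"
    by (intro order_ge_mult_left order_ge_mono[OF order_ge_linear_poly_power]) simp
  then have "order_ge (Suc d) (p - linear_poly a ^ k * h + linear_poly a ^ k * h)"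
    using h by (intro order_ge_add) (simp_all add: mult.commute)
  then have "p = 0" using p by (intro degree_order_disjoint) simp_all
  then show ?thesis by simp
qed

section \<open>The truncated ring and powers of principal ideals\<close>

lemma ring_of_type_algebra_simps [simp]:
  "carrier ring_of_type_algebra = UNIV" "x \<otimes>\<^bsub>ring_of_type_algebra\<^esub> y = x * y"
  "\<one>\<^bsub>ring_of_type_algebra\<^esub> = 1" "\<zero>\<^bsub>ring_of_type_algebra\<^esub> = 0"
  "x \<oplus>\<^bsub>ring_of_type_algebra\<^esub> y = x + y"
  by (simp_all add: ring_of_type_algebra_def)

lemma ideal_type_algebraI:
  fixes I :: "'a::comm_ring_1 set"
  assumes "0 \<in> I" "\<And>x y. x \<in> I \<Longrightarrow> y \<in> I \<Longrightarrow> x + y \<in> I" "\<And>x y. x \<in> I \<Longrightarrow> y * x \<in> I"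
  shows "ideal I ring_of_type_algebra"
proof (rule idealI[OF ring_from_type_algebra])
  interpret ring "ring_of_type_algebra :: 'a ring" by (rule ring_from_type_algebra)
  show "subgroup I (add_monoid ring_of_type_algebra)"
  proof (rule add.subgroupI)
    fix a assume "a \<in> I"
    have "\<ominus>\<^bsub>ring_of_type_algebra\<^esub> a = - a"
      using minus_equality[of "- a" a] by simp
    moreover have "- a \<in> I" using assms(3)[OF \<open>a \<in> I\<close>, of "- 1"] by simp
    ultimately show "\<ominus>\<^bsub>ring_of_type_algebra\<^esub> a \<in> I" by simp
  qed (use assms in auto)
qed (use assms(3) in \<open>auto simp: mult.commute\<close>)

lemma ideal_order_ge: "ideal {p. order_ge k p} (mpoly_ring :: 'n::finite mpoly ring)"
  by (rule ideal_type_algebraI) (auto intro: order_ge_add order_ge_mult_left)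

text \<open>A monomial of degree at least \<open>k\<close> is a multiple of one of degree exactly
  \<open>k\<close>, so the generated ideal absorbs a polynomial of order at least \<open>k\<close>
  monomial by monomial.\<close>

lemma trunc_ideal_eq: "trunc_ideal k = {p :: 'n::finite mpoly. order_ge k p}"
proof
  show "trunc_ideal k \<subseteq> {p :: 'n mpoly. order_ge k p}"
    unfolding trunc_ideal_def genideal_def using ideal_order_ge[of k]
    by (auto simp: order_ge_def homogeneous_of_def)
  have "p \<in> J"
    if J: "ideal J (mpoly_ring :: 'n mpoly ring)" "{p. homogeneous_of k p} \<subseteq> J" and "order_ge k p"
    for J and p :: "'n mpoly"
    using \<open>order_ge k p\<close>
  proof (induction p rule: Poly_Mapping.update_induct)
    case const
    show ?case using additive_subgroup.zero_closed[OF ideal.axioms(1)[OF J(1)]] by simp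
  next
    case (update f m b)
    have keys: "Poly_Mapping.keys (Poly_Mapping.update m b f) = insert m (Poly_Mapping.keys f)"
      using update.hyps by (simp add: keys_update)
    then have "f \<in> J" using update.IH update.prems by (auto simp: order_ge_def)
    have "k \<le> mono_degree m" using update.prems keys by (auto simp: order_ge_def)
    then obtain m1 m2 where m: "m = m1 + m2" "mono_degree m1 = k" using mono_degree_split by blast
    then have "Poly_Mapping.single m1 1 \<in> J"
      using J(2) by (auto simp: homogeneous_of_def)
    then have "Poly_Mapping.single m2 b * Poly_Mapping.single m1 1 \<in> J"
      using ideal.I_l_closed[OF J(1)] by simp
    then have "Poly_Mapping.single m b \<in> J" by (simp add: mult_single m(1) add.commute)
    then have "f + Poly_Mapping.single m b \<in> J"
      using additive_subgroup.a_closed[OF ideal.axioms(1)[OF J(1)] \<open>f \<in> J\<close>] by simp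
    then show ?case by (simp only: update_eq_add_single[OF update.hyps(1)])
  qed
  then show "{p :: 'n mpoly. order_ge k p} \<subseteq> trunc_ideal k"
    unfolding trunc_ideal_def genideal_def by blast
qed

lemma trunc_map_eq_iff: "trunc_map k p = trunc_map k q \<longleftrightarrow> order_ge k (p - q)"
proof -
  have eq: "trunc_map k p = {i + p | i. order_ge k i}" for p
    by (auto simp: trunc_map_def a_r_coset_def' trunc_ideal_eq)
  show ?thesis
  proof
    assume "trunc_map k p = trunc_map k q"
    moreover have "0 + p \<in> trunc_map k p" unfolding eq by (rule CollectI, rule exI[of _ 0]) simp
    ultimately have "p \<in> trunc_map k q" by simp
    then show "order_ge k (p - q)" unfolding eq by auto
  next
    assume *: "order_ge k (p - q)"
    have "i + p = (i + (p - q)) + q" "i + q = (i - (p - q)) + p" for i by simp_all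
    then show "trunc_map k p = trunc_map k q"
      unfolding eq using order_ge_add[OF _ *] order_ge_diff[OF _ *] by blast
  qed
qed

lemma ideal_trunc_ideal: "ideal (trunc_ideal k) (mpoly_ring :: 'n::finite mpoly ring)"
  unfolding trunc_ideal_eq by (rule ideal_order_ge)

lemma cring_trunc_ring: "cring (trunc_ring k :: 'n::finite mpoly set ring)"
  unfolding trunc_ring_def
  by (rule ideal.quotient_is_cring[OF ideal_trunc_ideal cring_from_type_algebra])

lemma trunc_map_hom: "trunc_map k \<in> ring_hom (mpoly_ring :: 'n::finite mpoly ring) (trunc_ring k)"
  using ideal.rcos_ring_hom[OF ideal_trunc_ideal] by (simp add: trunc_map_def[abs_def] trunc_ring_def)

lemma trunc_map_add: "trunc_map k p \<oplus>\<^bsub>trunc_ring k\<^esub> trunc_map k q = trunc_map k (p + q)"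
  using ring_hom_add[OF trunc_map_hom, of p q k] by simp

lemma trunc_map_mult: "trunc_map k p \<otimes>\<^bsub>trunc_ring k\<^esub> trunc_map k q = trunc_map k (p * q)"
  using ring_hom_mult[OF trunc_map_hom, of p q k] by simp

lemma trunc_map_0: "trunc_map k 0 = \<zero>\<^bsub>trunc_ring k\<^esub>"
  using ring_hom_zero[OF trunc_map_hom ring_from_type_algebra cring.axioms(1)[OF cring_trunc_ring]]
  by simp

lemma trunc_map_closed [simp]: "trunc_map k p \<in> carrier (trunc_ring k)"
  using ring_hom_closed[OF trunc_map_hom, of p k] by simp

lemma carrier_trunc_ring: "carrier (trunc_ring k) = range (trunc_map k)"
  by (auto simp: trunc_ring_def FactRing_def A_RCOSETS_def' trunc_map_def)

lemma trunc_map_diff: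
  fixes p q :: "'n::finite mpoly"
  shows "trunc_map k p \<ominus>\<^bsub>trunc_ring k\<^esub> trunc_map k q = trunc_map k (p - q)"
proof -
  interpret cring "trunc_ring k :: 'n mpoly set ring" by (rule cring_trunc_ring)
  have "\<ominus>\<^bsub>trunc_ring k\<^esub> trunc_map k q = trunc_map k (- q)"
    by (rule minus_equality) (simp_all add: trunc_map_add trunc_map_0)
  then show ?thesis by (simp add: a_minus_def trunc_map_add)
qed

lemma PIdl_type_algebra: "PIdl\<^bsub>ring_of_type_algebra\<^esub> l = {p :: 'a::comm_ring_1. l dvd p}"
  by (auto simp: cgenideal_def dvd_def mult.commute)

lemma ideal_power_PIdl:
  "ideal_power ring_of_type_algebra {p :: 'a::comm_ring_1. l dvd p} k = {p. l ^ k dvd p}"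
proof (induction k)
  case 0
  show ?case by simp
next
  case (Suc k)
  have "p \<in> ideal_prod ring_of_type_algebra {p. l dvd p} {p. l ^ k dvd p} \<longleftrightarrow> l ^ Suc k dvd p" for p
  proof
    assume "p \<in> ideal_prod ring_of_type_algebra {p. l dvd p} {p. l ^ k dvd p}"
    then show "l ^ Suc k dvd p"
      by induction (auto intro: mult_dvd_mono)
  next
    assume "l ^ Suc k dvd p"
    then obtain h where "p = l * (l ^ k * h)" by (auto elim!: dvdE simp: mult.assoc)
    then show "p \<in> ideal_prod ring_of_type_algebra {p. l dvd p} {p. l ^ k dvd p}"
      using ideal_prod.prod[of l "{p. l dvd p}" "l ^ k * h" "{p. l ^ k dvd p}" ring_of_type_algebra]
      by simp
  qed
  then show ?case using Suc by auto
qed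

section \<open>Paths in the dual graph\<close>

text \<open>Faces of a simplex are spanned by subsets of its vertices, and the remaining vertices
  span the opposite face. For \<open>\<sigma> = u\<close> this is the empty simplex.\<close>

lemma simplex_complementary_face:
  assumes "k simplex u" "\<sigma> face_of u"
  obtains \<tau> where "\<tau> face_of u" "\<sigma> \<inter> \<tau> = {}" "convex hull (\<sigma> \<union> \<tau>) = u"
proof -
  obtain B where B: "\<not> affine_dependent B" "u = convex hull B"
    using assms(1) by (auto simp: simplex_def)
  obtain C where C: "C \<subseteq> B" "\<sigma> = convex hull C"
    using assms(2) face_of_convex_hull_affine_independent[OF B(1)] B(2) by auto
  show thesis
  proof (rule that)
    show "convex hull (B - C) face_of u"
      using face_of_convex_hull_affine_independent[OF B(1)] B(2) by blast
    have "affine hull C \<inter> affine hull (B - C) = {}"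
      using disjoint_affine_hull[OF B(1) C(1)] by blast
    then show "\<sigma> \<inter> convex hull (B - C) = {}"
      unfolding C(2) using convex_hull_subset_affine_hull by blast
    have "convex hull (\<sigma> \<union> convex hull (B - C)) = convex hull (C \<union> (B - C))"
      unfolding C(2) by (simp flip: hull_Un_left hull_Un_right)
    then show "convex hull (\<sigma> \<union> convex hull (B - C)) = u"
      using C(1) B(2) by (simp add: Un_absorb1)
  qed
qed

text \<open>A simplex has one more vertex than its dimension, and the disjoint vertex sets of the
  two faces add up. The count includes the empty face, of dimension -1.\<close>

lemma aff_dim_join_faces:
  assumes "k simplex w" "\<sigma> face_of w" "\<tau> face_of w" "\<sigma> \<inter> \<tau> = {}"
  shows "aff_dim (convex hull (\<sigma> \<union> \<tau>)) = aff_dim \<sigma> + aff_dim \<tau> + 1"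
proof -
  obtain B where B: "\<not> affine_dependent B" "w = convex hull B"
    using assms(1) by (auto simp: simplex_def)
  obtain C where C: "C \<subseteq> B" "\<sigma> = convex hull C"
    using assms(2) face_of_convex_hull_affine_independent[OF B(1)] B(2) by auto
  obtain D where D: "D \<subseteq> B" "\<tau> = convex hull D"
    using assms(3) face_of_convex_hull_affine_independent[OF B(1)] B(2) by auto
  have "C \<inter> D = {}" using assms(4) C(2) D(2) hull_subset[of C convex] hull_subset[of D convex] by blast
  have indep: "\<not> affine_dependent C" "\<not> affine_dependent D" "\<not> affine_dependent (C \<union> D)"
    using affine_independent_subset[OF B(1)] C(1) D(1) by auto
  then have "finite C" "finite D" using aff_independent_finite by auto
  then have "card (C \<union> D) = card C + card D" using \<open>C \<inter> D = {}\<close> by (rule card_Un_disjoint)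
  moreover have "convex hull (\<sigma> \<union> \<tau>) = convex hull (C \<union> D)"
    unfolding C(2) D(2) by (simp flip: hull_Un_left hull_Un_right)
  ultimately show ?thesis
    using indep[THEN aff_dim_affine_independent] by (simp add: C(2) D(2) aff_dim_convex_hull)
qed

lemma pure_complexD:
  "pure_complex \<Delta> \<Longrightarrow> \<sigma> \<in> maximal_simplices \<Delta> \<Longrightarrow> \<tau> \<in> maximal_simplices \<Delta> \<Longrightarrow> aff_dim \<sigma> = aff_dim \<tau>"
  unfolding pure_complex_def by blast

lemma convex_hull_subset_join:
  assumes "w = convex hull (\<sigma> \<union> \<tau>)"
  shows "\<sigma> \<subseteq> w" "\<tau> \<subseteq> w"
  using assms hull_subset[of "\<sigma> \<union> \<tau>" convex] by auto

section \<open>Joins, links and paths in a fixed complex\<close>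

context
  fixes \<Delta> :: "(real ^ 'n::finite) set set"
  assumes complex: "simplicial_complex \<Delta>"
begin

lemma complex_simplex: "\<sigma> \<in> \<Delta> \<Longrightarrow> (aff_dim \<sigma>) simplex \<sigma>"
proof -
  assume "\<sigma> \<in> \<Delta>"
  then obtain k where "k simplex \<sigma>" using complex unfolding simplicial_complex_def by blast
  then show ?thesis using aff_dim_simplex[of k \<sigma>] by simp
qed

lemma complex_face: "\<sigma> \<in> \<Delta> \<Longrightarrow> \<tau> face_of \<sigma> \<Longrightarrow> \<tau> \<in> \<Delta>"
  using complex unfolding simplicial_complex_def by blast

lemma complex_Int_face: "\<sigma> \<in> \<Delta> \<Longrightarrow> \<tau> \<in> \<Delta> \<Longrightarrow> \<sigma> \<inter> \<tau> face_of \<sigma>"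
  using complex unfolding simplicial_complex_def by blast

lemma complex_subset_face: "\<sigma> \<in> \<Delta> \<Longrightarrow> \<tau> \<in> \<Delta> \<Longrightarrow> \<tau> \<subseteq> \<sigma> \<Longrightarrow> \<tau> face_of \<sigma>"
  using complex_Int_face[of \<sigma> \<tau>] by (simp add: Int_absorb1)

lemma complex_convex: "\<sigma> \<in> \<Delta> \<Longrightarrow> convex \<sigma>"
  using complex_simplex convex_simplex by blast

lemma complex_face_eq:
  assumes "\<sigma> \<in> \<Delta>" "\<tau> \<in> \<Delta>" "\<tau> \<subseteq> \<sigma>" "aff_dim \<sigma> \<le> aff_dim \<tau>"
  shows "\<tau> = \<sigma>"
  using face_of_aff_dim_lt[OF complex_convex[OF assms(1)] complex_subset_face[OF assms(1-3)]] assms(4)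
  by linarith

lemma dual_vertices_iff: "v \<in> dual_vertices \<Delta> \<longleftrightarrow> v \<in> \<Delta> \<and> aff_dim v = int CARD('n)"
proof
  assume "v \<in> \<Delta> \<and> aff_dim v = int CARD('n)"
  then show "v \<in> dual_vertices \<Delta>" using complex_simplex[of v] by (simp add: dual_vertices_def)
qed (simp add: dual_vertices_def aff_dim_simplex)

lemma finite_dual_vertices: "finite (dual_vertices \<Delta>)"
  using complex by (simp add: simplicial_complex_def dual_vertices_def)

lemma dual_vertex_closed: "v \<in> dual_vertices \<Delta> \<Longrightarrow> closed v"
  using closed_simplex by (auto simp: dual_vertices_def)

lemma dual_vertex_convex: "v \<in> dual_vertices \<Delta> \<Longrightarrow> convex v"
  using convex_simplex by (auto simp: dual_vertices_def)

lemma dual_vertex_affine_hull: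
  assumes "v \<in> dual_vertices \<Delta>"
  shows "affine hull v = UNIV"
proof -
  have "aff_dim v = DIM(real ^ 'n)" using assms by (simp add: dual_vertices_iff)
  then show ?thesis by (simp only: aff_dim_eq_full)
qed

lemma dual_vertex_interior:
  assumes "v \<in> dual_vertices \<Delta>"
  shows "interior v \<noteq> {}"
proof -
  have "v \<noteq> {}" using assms by (auto simp: dual_vertices_iff)
  then have "rel_interior v \<noteq> {}" using rel_interior_eq_empty[OF dual_vertex_convex[OF assms]] by simp
  then show ?thesis by (simp add: rel_interior_interior[OF dual_vertex_affine_hull[OF assms]])
qed

text \<open>The common codimension-one face \<open>\<rho>\<close> of \<open>t1\<close> and
  \<open>t2\<close>, joined with \<open>\<sigma>\<close>, gives dimension n - 1 inside the
  intersection of the two n-simplices. Dimension n is impossible, because each of them would then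
  equal the intersection.\<close>

lemma join_step:
  assumes "\<sigma> \<in> \<Delta>" "t1 \<in> link \<Delta> \<sigma>" "t2 \<in> link \<Delta> \<sigma>"
    and dim: "aff_dim \<sigma> + aff_dim t1 + 1 = int CARD('n)" "aff_dim t2 = aff_dim t1"
    and share: "share_codim1_face t1 t2"
    and ne: "convex hull (\<sigma> \<union> t1) \<noteq> convex hull (\<sigma> \<union> t2)"
  shows "{convex hull (\<sigma> \<union> t1), convex hull (\<sigma> \<union> t2)} \<in> dual_edges \<Delta>"
proof -
  define w1 where "w1 = convex hull (\<sigma> \<union> t1)"
  define w2 where "w2 = convex hull (\<sigma> \<union> t2)"
  have w: "w1 \<in> \<Delta>" "w2 \<in> \<Delta>" and t: "t1 \<in> \<Delta>" "t2 \<in> \<Delta>" "\<sigma> \<inter> t1 = {}" "\<sigma> \<inter> t2 = {}"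
    using assms(2,3) by (auto simp: link_def w1_def w2_def)
  have I: "w1 \<inter> w2 \<in> \<Delta>" using w complex_Int_face complex_face by blast
  have faces: "\<sigma> face_of w1" "\<sigma> face_of w2" "t1 face_of w1" "t2 face_of w2"
    using w t assms(1) convex_hull_subset_join[OF w1_def] convex_hull_subset_join[OF w2_def]
    by (auto intro: complex_subset_face)
  have dims: "aff_dim w1 = int CARD('n)" "aff_dim w2 = int CARD('n)"
    using aff_dim_join_faces[OF complex_simplex[OF w(1)] faces(1,3) t(3)]
      aff_dim_join_faces[OF complex_simplex[OF w(2)] faces(2,4) t(4)] dim
    by (simp_all add: w1_def w2_def)
  obtain \<rho> where \<rho>: "\<rho> face_of t1" "\<rho> face_of t2" "aff_dim \<rho> = aff_dim t1 - 1"
    using share by (auto simp: share_codim1_face_def)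
  have "\<rho> face_of w1" using face_of_trans[OF \<rho>(1) faces(3)] .
  moreover have "\<sigma> \<inter> \<rho> = {}" using t(3) face_of_imp_subset[OF \<rho>(1)] by blast
  ultimately have "aff_dim (convex hull (\<sigma> \<union> \<rho>)) = int CARD('n) - 1"
    using aff_dim_join_faces[OF complex_simplex[OF w(1)] faces(1)] \<rho>(3) dim by simp
  moreover have "convex hull (\<sigma> \<union> \<rho>) \<subseteq> w1 \<inter> w2"
  proof (rule hull_minimal)
    show "\<sigma> \<union> \<rho> \<subseteq> w1 \<inter> w2"
      using faces(1,2)[THEN face_of_imp_subset] \<rho>(1,2)[THEN face_of_imp_subset]
        faces(3,4)[THEN face_of_imp_subset] by blast
    show "convex (w1 \<inter> w2)" using w by (intro convex_Int complex_convex)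
  qed
  ultimately have "int CARD('n) - 1 \<le> aff_dim (w1 \<inter> w2)"
    using aff_dim_subset by metis
  moreover have "aff_dim (w1 \<inter> w2) < int CARD('n)"
  proof (rule ccontr)
    assume "\<not> ?thesis"
    then have "w1 \<inter> w2 = w1" "w1 \<inter> w2 = w2"
      using complex_face_eq[OF w(1) I] complex_face_eq[OF w(2) I] dims by auto
    then show False using ne by (simp add: w1_def w2_def)
  qed
  ultimately have "aff_dim (w1 \<inter> w2) = int CARD('n) - 1" by linarith
  then have "(int CARD('n) - 1) simplex (w1 \<inter> w2)"
    using complex_simplex[OF I] by simp
  then have "{w1, w2} \<in> dual_edges \<Delta>"
    using w dims by (auto simp: dual_edges_def dual_vertices_iff)
  then show ?thesis by (simp add: w1_def w2_def)
qed

context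
  assumes cdim: "complex_dim (int CARD('n)) \<Delta>"
    and links: "\<And>\<sigma>. \<sigma> \<in> \<Delta> \<Longrightarrow> strongly_connected (link \<Delta> \<sigma>)"
begin

text \<open>Joining \<open>\<sigma>\<close> with any member of its link gives a simplex of dimension
  at most n. The face of \<open>u\<close> opposite to \<open>\<sigma>\<close> attains this bound, so
  nothing in the link can strictly contain it.\<close>

lemma complementary_face_maximal_link:
  assumes u: "u \<in> dual_vertices \<Delta>" and \<sigma>: "\<sigma> \<in> \<Delta>" "\<sigma> \<subseteq> u"
  obtains \<tau> where "\<tau> \<in> maximal_simplices (link \<Delta> \<sigma>)" "convex hull (\<sigma> \<union> \<tau>) = u"
    "aff_dim \<sigma> + aff_dim \<tau> + 1 = int CARD('n)"
proof -
  have u': "u \<in> \<Delta>" "aff_dim u = int CARD('n)" using u by (auto simp: dual_vertices_iff)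
  have face: "\<sigma> face_of u" using complex_subset_face u'(1) \<sigma> by blast
  then obtain \<tau> where \<tau>: "\<tau> face_of u" "\<sigma> \<inter> \<tau> = {}" "convex hull (\<sigma> \<union> \<tau>) = u"
    using simplex_complementary_face[OF complex_simplex[OF u'(1)]] by blast
  have dim: "aff_dim \<sigma> + aff_dim \<tau> + 1 = int CARD('n)"
    using aff_dim_join_faces[OF complex_simplex[OF u'(1)] face \<tau>(1,2)] \<tau>(3) u'(2) by simp
  have "\<tau> \<in> \<Delta>" using complex_face[OF u'(1) \<tau>(1)] .
  then have "\<tau> \<in> link \<Delta> \<sigma>" using \<tau> u'(1) by (simp add: link_def)
  moreover have "\<tau>' = \<tau>" if \<tau>': "\<tau>' \<in> link \<Delta> \<sigma>" "\<tau> \<subseteq> \<tau>'" for \<tau>'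
  proof -
    define w where "w = convex hull (\<sigma> \<union> \<tau>')"
    have w: "w \<in> \<Delta>" "\<tau>' \<in> \<Delta>" "\<sigma> \<inter> \<tau>' = {}" using \<tau>'(1) by (auto simp: link_def w_def)
    have "aff_dim w = aff_dim \<sigma> + aff_dim \<tau>' + 1"
      using aff_dim_join_faces[OF complex_simplex[OF w(1)] _ _ w(3)]
        complex_subset_face[OF w(1)] w(2) \<sigma>(1) convex_hull_subset_join[OF w_def]
      by (simp add: w_def)
    moreover have "aff_dim w \<le> int CARD('n)" using cdim w(1) by (auto simp: complex_dim_def)
    ultimately have "aff_dim \<tau>' \<le> aff_dim \<tau>" using dim by simp
    then show ?thesis using complex_face_eq[OF w(2) \<open>\<tau> \<in> \<Delta>\<close> \<tau>'(2)] by simp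
  qed
  ultimately have "\<tau> \<in> maximal_simplices (link \<Delta> \<sigma>)" by (auto simp: maximal_simplices_def)
  then show thesis using that \<tau>(3) dim by blast
qed

text \<open>The faces of \<open>u\<close> and \<open>v\<close> opposite to
  \<open>u \<inter> v\<close> are connected inside its link. Joining each simplex of that path with
  \<open>u \<inter> v\<close> gives n-simplices that all contain \<open>x\<close>.\<close>

lemma dual_path:
  assumes u: "u \<in> dual_vertices \<Delta>" and v: "v \<in> dual_vertices \<Delta>" and x: "x \<in> u" "x \<in> v"
  shows "(\<lambda>a b. a \<in> dual_vertices \<Delta> \<and> b \<in> dual_vertices \<Delta> \<and> {a, b} \<in> dual_edges \<Delta> \<and> x \<in> a \<inter> b)\<^sup>*\<^sup>* u v"
    (is "?R\<^sup>*\<^sup>* u v")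
proof -
  let ?\<sigma> = "u \<inter> v"
  let ?M = "maximal_simplices (link \<Delta> ?\<sigma>)"
  let ?w = "\<lambda>t. convex hull (?\<sigma> \<union> t)"
  have \<sigma>: "?\<sigma> \<in> \<Delta>" using u v complex_Int_face complex_face unfolding dual_vertices_iff by blast
  obtain t where t: "t \<in> ?M" "?w t = u" "aff_dim ?\<sigma> + aff_dim t + 1 = int CARD('n)"
    using complementary_face_maximal_link[OF u \<sigma>] by blast
  obtain t' where t': "t' \<in> ?M" "?w t' = v"
    using complementary_face_maximal_link[OF v \<sigma>] by blast
  have path: "(\<lambda>\<alpha> \<beta>. \<alpha> \<in> ?M \<and> \<beta> \<in> ?M \<and> share_codim1_face \<alpha> \<beta>)\<^sup>*\<^sup>* t t'"
    using links[OF \<sigma>] t(1) t'(1) unfolding strongly_connected_def by blast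
  have link_pure: "pure_complex (link \<Delta> ?\<sigma>)"
    using links[OF \<sigma>] by (simp add: strongly_connected_def)
  from path have "?R\<^sup>*\<^sup>* (?w t) (?w t')"
  proof (induction rule: rtranclp_induct)
    case base
    show ?case by simp
  next
    case (step y z)
    have yz: "y \<in> link \<Delta> ?\<sigma>" "z \<in> link \<Delta> ?\<sigma>" using step.hyps(2) by (auto simp: maximal_simplices_def)
    \<comment> \<open>By purity all members of the path have the dimension of \<open>t\<close>, so
      their joins with \<open>u \<inter> v\<close> are n-dimensional.\<close>
    have pure: "aff_dim y = aff_dim t" "aff_dim z = aff_dim t"
      using pure_complexD[OF link_pure _ t(1)] step.hyps(2) by blast+
    show ?case
    proof (cases "?w y = ?w z")
      \<comment> \<open>Consecutive members may coincide, as \<open>share_codim1_face\<close> does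
        not require distinct simplices; the dual path then stays where it is.\<close>
      case True
      then show ?thesis using step.IH by simp
    next
      case False
      then have "{?w y, ?w z} \<in> dual_edges \<Delta>"
        using join_step[OF \<sigma> yz] pure t(3) step.hyps(2) by simp
      moreover from this have "?w y \<in> dual_vertices \<Delta>" "?w z \<in> dual_vertices \<Delta>"
        by (auto simp: dual_edges_def doubleton_eq_iff)
      moreover have "x \<in> ?w y \<inter> ?w z" using x by (auto intro: hull_inc)
      ultimately have "?R (?w y) (?w z)" by simp
      with step.IH show ?thesis by (rule rtranclp.rtrancl_into_rtrancl)
    qed
  qed
  then show ?thesis using t(2) t'(2) by simp
qed

end

text \<open>A simplex of top dimension is maximal, so by purity every maximal simplex has dimension
  n. Hence the values on the n-simplices determine a function on the whole underlying space.\<close>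

lemma Union_dual_vertices:
  assumes cdim: "complex_dim (int CARD('n)) \<Delta>" and pure: "pure_complex \<Delta>"
  shows "\<Union>(dual_vertices \<Delta>) = \<Union>\<Delta>"
proof
  show "\<Union>(dual_vertices \<Delta>) \<subseteq> \<Union>\<Delta>" by (auto simp: dual_vertices_def)
  have fin: "finite \<Delta>" using complex by (simp add: simplicial_complex_def)
  obtain \<tau> where \<tau>: "\<tau> \<in> \<Delta>" "aff_dim \<tau> = int CARD('n)" using cdim by (auto simp: complex_dim_def)
  have "\<tau>' = \<tau>" if "\<tau>' \<in> \<Delta>" "\<tau> \<subseteq> \<tau>'" for \<tau>'
    using complex_face_eq[OF that(1) \<tau>(1) that(2)] cdim that(1) \<tau>(2) by (auto simp: complex_dim_def)
  then have "\<tau> \<in> maximal_simplices \<Delta>" using \<tau>(1) by (auto simp: maximal_simplices_def)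
  show "\<Union>\<Delta> \<subseteq> \<Union>(dual_vertices \<Delta>)"
  proof
    fix x assume "x \<in> \<Union>\<Delta>"
    then obtain \<sigma> where \<sigma>: "\<sigma> \<in> \<Delta>" "x \<in> \<sigma>" by auto
    obtain m where m: "m \<in> \<Delta>" "\<sigma> \<subseteq> m" "\<And>b. b \<in> \<Delta> \<Longrightarrow> m \<subseteq> b \<Longrightarrow> m = b"
      using finite_has_maximal2[OF fin \<sigma>(1)] by metis
    then have "m \<in> maximal_simplices \<Delta>" by (auto simp: maximal_simplices_def)
    then have "aff_dim m = int CARD('n)"
      using pure_complexD[OF pure _ \<open>\<tau> \<in> maximal_simplices \<Delta>\<close>] \<tau>(2) by simp
    then have "m \<in> dual_vertices \<Delta>" using m(1) by (simp add: dual_vertices_iff)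
    then show "x \<in> \<Union>(dual_vertices \<Delta>)" using m(2) \<sigma>(2) by auto
  qed
qed

end

section \<open>Spline functions and graph splines\<close>

text \<open>The target inherits the module axioms along the bijection. This spares a separate proof
  that graph splines, given as a bare record, form a module over the reals.\<close>

lemma module_iso_transport:
  assumes M: "module K M" and f: "bij_betw f (carrier M) (carrier N)"
    and add: "\<And>x y. x \<in> carrier M \<Longrightarrow> y \<in> carrier M \<Longrightarrow> f (x \<oplus>\<^bsub>M\<^esub> y) = f x \<oplus>\<^bsub>N\<^esub> f y"
    and smult: "\<And>a x. a \<in> carrier K \<Longrightarrow> x \<in> carrier M \<Longrightarrow> f (a \<odot>\<^bsub>M\<^esub> x) = a \<odot>\<^bsub>N\<^esub> f x"
    and zero: "f \<zero>\<^bsub>M\<^esub> = \<zero>\<^bsub>N\<^esub>"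
  shows "module_iso K M N f"
proof -
  interpret M: module K M by (rule M)
  have N: "carrier N = f ` carrier M" using f by (simp add: bij_betw_def)
  have "abelian_group N"
  proof (rule abelian_groupI)
    show "x \<oplus>\<^bsub>N\<^esub> y \<in> carrier N" if "x \<in> carrier N" "y \<in> carrier N" for x y
      using that unfolding N by (auto simp flip: add)
    show "\<zero>\<^bsub>N\<^esub> \<in> carrier N" unfolding N zero[symmetric] by simp
    show "x \<oplus>\<^bsub>N\<^esub> y \<oplus>\<^bsub>N\<^esub> z = x \<oplus>\<^bsub>N\<^esub> (y \<oplus>\<^bsub>N\<^esub> z)"
      if "x \<in> carrier N" "y \<in> carrier N" "z \<in> carrier N" for x y z
      using that unfolding N by (auto simp: M.a_assoc simp flip: add)
    show "x \<oplus>\<^bsub>N\<^esub> y = y \<oplus>\<^bsub>N\<^esub> x" if "x \<in> carrier N" "y \<in> carrier N" for x y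
      using that unfolding N by (auto simp: M.a_comm simp flip: add)
    show "\<zero>\<^bsub>N\<^esub> \<oplus>\<^bsub>N\<^esub> x = x" if "x \<in> carrier N" for x
      using that unfolding N by (auto simp flip: add zero)
    show "\<exists>y\<in>carrier N. y \<oplus>\<^bsub>N\<^esub> x = \<zero>\<^bsub>N\<^esub>" if x: "x \<in> carrier N" for x
    proof -
      obtain x' where x': "x' \<in> carrier M" "x = f x'" using x unfolding N by blast
      then have "f (\<ominus>\<^bsub>M\<^esub> x') \<oplus>\<^bsub>N\<^esub> x = \<zero>\<^bsub>N\<^esub>"
        by (simp add: M.l_neg flip: add zero)
      then show ?thesis using x'(1) N by blast
    qed
  qed
  then have "module K N"
  proof (rule moduleI[OF M.R.is_cring])
    show "a \<odot>\<^bsub>N\<^esub> x \<in> carrier N" if "a \<in> carrier K" "x \<in> carrier N" for a x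
      using that unfolding N by (auto simp flip: smult)
    show "(a \<oplus>\<^bsub>K\<^esub> b) \<odot>\<^bsub>N\<^esub> x = a \<odot>\<^bsub>N\<^esub> x \<oplus>\<^bsub>N\<^esub> b \<odot>\<^bsub>N\<^esub> x"
      if "a \<in> carrier K" "b \<in> carrier K" "x \<in> carrier N" for a b x
      using that unfolding N by (auto simp: M.smult_l_distr simp flip: smult add)
    show "a \<odot>\<^bsub>N\<^esub> (x \<oplus>\<^bsub>N\<^esub> y) = a \<odot>\<^bsub>N\<^esub> x \<oplus>\<^bsub>N\<^esub> a \<odot>\<^bsub>N\<^esub> y"
      if "a \<in> carrier K" "x \<in> carrier N" "y \<in> carrier N" for a x y
      using that unfolding N by (auto simp: M.smult_r_distr simp flip: smult add)
    show "(a \<otimes>\<^bsub>K\<^esub> b) \<odot>\<^bsub>N\<^esub> x = a \<odot>\<^bsub>N\<^esub> (b \<odot>\<^bsub>N\<^esub> x)"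
      if "a \<in> carrier K" "b \<in> carrier K" "x \<in> carrier N" for a b x
      using that unfolding N by (auto simp: M.smult_assoc1 simp flip: smult)
    show "\<one>\<^bsub>K\<^esub> \<odot>\<^bsub>N\<^esub> x = x" if "x \<in> carrier N" for x
      using that unfolding N by (auto simp flip: smult)
  qed
  with M f add smult show ?thesis by (simp add: module_iso_def)
qed

section \<open>Edge labels and the truncated edge condition\<close>

text \<open>One vector serves both sides: the geometry needs the hyperplane spanned by the facet,
  the algebra a generator of the label. The missing constant term encodes that the hyperplane passes
  through the origin.\<close>

definition label_form :: "(real ^ 'n::finite) set set \<Rightarrow> real ^ 'n \<Rightarrow> bool" where
  "label_form e a \<longleftrightarrow>
    a \<noteq> 0 \<and> affine hull (\<Inter>e) = {x. a \<bullet> x = 0} \<and> dual_label e = {p. linear_poly a dvd p}"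

text \<open>A homogeneous generator of positive degree vanishes at the origin, so the hyperplane
  spanned by the common facet is linear.\<close>

lemma dual_edge_label_form:
  fixes \<Delta> :: "(real ^ 'n::finite) set set"
  assumes e: "e \<in> dual_edges \<Delta>"
    and g: "homogeneous g" "dual_label e = PIdl\<^bsub>mpoly_ring\<^esub> (g :: 'n mpoly)"
  shows "\<exists>a. label_form e a"
proof -
  let ?H = "affine hull (\<Inter>e)"
  let ?Q = "\<lambda>l :: 'n mpoly. degree_le 1 l \<and> l \<noteq> 0 \<and> (\<forall>x\<in>\<Inter>e. poly_eval l x = 0)"
  have "(int CARD('n) - 1) simplex (\<Inter>e)" using e by (auto simp: dual_edges_def)
  then have dim: "aff_dim (\<Inter>e) = int CARD('n) - 1" by (rule aff_dim_simplex)
  have ne: "\<Inter>e \<noteq> {}"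
  proof
    assume "\<Inter>e = {}"
    with dim have "int CARD('n) = 0" by simp
    then show False by simp
  qed
  obtain a0 b0 where a0: "a0 \<noteq> 0" "?H = {x. a0 \<bullet> x = b0}"
    using aff_dim_eq_hyperplane[of "\<Inter>e"] dim by (auto simp: of_nat_diff)
  \<comment> \<open>A witness is needed before anything is known about the form chosen by
    \<open>SOME\<close>; at this stage the hyperplane may still miss the origin.\<close>
  have "?Q (linear_poly a0 + poly_const (- b0))"
  proof (intro conjI ballI)
    show "degree_le 1 (linear_poly a0 + poly_const (- b0))"
      by (intro degree_le_add degree_le_linear_poly degree_le_const)
    show "poly_eval (linear_poly a0 + poly_const (- b0)) x = 0" if "x \<in> \<Inter>e" for x
      using hull_inc[OF that, of affine] a0(2) by simp
    show "linear_poly a0 + poly_const (- b0) \<noteq> 0"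
    proof
      assume *: "linear_poly a0 + poly_const (- b0) = 0"
      have "poly_eval (linear_poly a0 + poly_const (- b0)) a0 = 0"
        "poly_eval (linear_poly a0 + poly_const (- b0)) 0 = 0"
        unfolding * by simp_all
      then show False using a0(1) by simp
    qed
  qed
  then have Q: "?Q (SOME l. ?Q l)" by (rule someI)
  define l where "l = (SOME l. ?Q l)"
  have l: "degree_le 1 l" "l \<noteq> 0" "\<And>x. x \<in> \<Inter>e \<Longrightarrow> poly_eval l x = 0"
    using Q unfolding l_def by blast+
  have label: "dual_label e = {p. l dvd p}"
    unfolding dual_label_def l_def by (rule PIdl_type_algebra)
  then have gl: "g dvd l" "l dvd g" using g(2) unfolding PIdl_type_algebra by auto
  have "poly_eval l 0 = 0"
  proof -
    obtain k where k: "homogeneous_of k g" using g(1) by (auto simp: homogeneous_def)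
    have "poly_eval g 0 = 0"
    proof (cases "k = 0")
      \<comment> \<open>A generator of degree 0 is constant, and as a multiple of \<open>l\<close>
        it vanishes on the nonempty facet, hence everywhere.\<close>
      case True
      obtain x where x: "x \<in> \<Inter>e" using ne by blast
      have "poly_eval g x = 0" using gl(2) l(3)[OF x] by (auto elim!: dvdE)
      moreover have "degree_le 0 g" using k True by (simp add: homogeneous_of_def degree_le_def)
      ultimately show ?thesis using degree_le_0_eval by metis
    next
      case False
      then show ?thesis using k by (intro order_ge_1_eval_0) (auto simp: homogeneous_of_def order_ge_def)
    qed
    then show ?thesis using gl(1) by (auto elim!: dvdE)
  qed
  obtain a c where ac: "l = linear_poly a + poly_const c" using degree_le_1_cases[OF l(1)] by blast
  then have "c = 0" using \<open>poly_eval l 0 = 0\<close> by simp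
  then have la: "l = linear_poly a" using ac by (intro poly_eval_inject) simp
  have "a \<noteq> 0"
  proof
    assume "a = 0"
    then have "l = 0" unfolding la by (intro poly_eval_inject) simp
    then show False using l(2) by simp
  qed
  moreover have "?H = {x. a \<bullet> x = 0}"
  proof (rule affine_dim_equal)
    show "affine ?H" by (rule affine_affine_hull)
    show "affine {x. a \<bullet> x = 0}" by (rule affine_hyperplane)
    show "?H \<noteq> {}" using ne by simp
    show "?H \<subseteq> {x. a \<bullet> x = 0}"
      using l(3) la by (intro hull_minimal affine_hyperplane) auto
    show "aff_dim ?H = aff_dim {x. a \<bullet> x = 0}"
      using dim \<open>a \<noteq> 0\<close> by (simp add: aff_dim_hyperplane)
  qed
  ultimately show ?thesis using label la unfolding label_form_def by blast
qed

text \<open>As \<open>trunc_map\<close> is a ring homomorphism, the edge condition asks for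
  divisibility up to terms of order above \<open>d\<close>. The degree bound on \<open>P\<close>
  upgrades this to divisibility in R by \<open>linear_poly_power_dvd_modulo_order\<close>.\<close>

lemma phi_family_in_carrier_iff:
  fixes \<Delta> :: "(real ^ 'n::finite) set set"
  assumes P: "\<And>v. v \<in> dual_vertices \<Delta> \<Longrightarrow> degree_le d (P v)"
    and label: "\<And>e. e \<in> dual_edges \<Delta> \<Longrightarrow> label_form e (a e)"
  shows "phi_family d \<Delta> P \<in> carrier (trunc_splines r d \<Delta>) \<longleftrightarrow>
    (\<forall>u\<in>dual_vertices \<Delta>. \<forall>v\<in>dual_vertices \<Delta>. {u, v} \<in> dual_edges \<Delta> \<longrightarrow>
      linear_poly (a {u, v}) ^ Suc r dvd P u - P v)"
proof -
  have "phi_family d \<Delta> P u \<ominus>\<^bsub>trunc_ring (d + 1)\<^esub> phi_family d \<Delta> P v \<in> trunc_label (d + 1) (r + 1) {u, v}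
      \<longleftrightarrow> linear_poly (a {u, v}) ^ Suc r dvd P u - P v"
    if uv: "u \<in> dual_vertices \<Delta>" "v \<in> dual_vertices \<Delta>" "{u, v} \<in> dual_edges \<Delta>" for u v
  proof -
    let ?l = "linear_poly (a {u, v})"
    have "trunc_label (d + 1) (r + 1) {u, v} = trunc_map (d + 1) ` {p. ?l ^ Suc r dvd p}"
      using label[OF uv(3)] by (simp add: trunc_label_def label_form_def ideal_power_PIdl
          del: ideal_power.simps)
    moreover have "phi_family d \<Delta> P u \<ominus>\<^bsub>trunc_ring (d + 1)\<^esub> phi_family d \<Delta> P v
        = trunc_map (d + 1) (P u - P v)"
      using uv(1,2) by (simp add: phi_family_def trunc_map_diff)
    moreover have "trunc_map (d + 1) (P u - P v) \<in> trunc_map (d + 1) ` {p. ?l ^ Suc r dvd p}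
        \<longleftrightarrow> ?l ^ Suc r dvd P u - P v"
    proof
      assume "trunc_map (d + 1) (P u - P v) \<in> trunc_map (d + 1) ` {p. ?l ^ Suc r dvd p}"
      then obtain h where "trunc_map (d + 1) (P u - P v) = trunc_map (d + 1) (?l ^ Suc r * h)"
        by (auto elim!: dvdE)
      then have "order_ge (Suc d) (P u - P v - ?l ^ Suc r * h)" by (simp add: trunc_map_eq_iff)
      then show "?l ^ Suc r dvd P u - P v"
        using linear_poly_power_dvd_modulo_order degree_le_diff[OF P P] uv(1,2) by blast
    qed simp
    ultimately show ?thesis by (simp only:)
  qed
  moreover have "phi_family d \<Delta> P \<in> dual_vertices \<Delta> \<rightarrow>\<^sub>E carrier (trunc_ring (d + 1))"
    by (simp add: phi_family_def)
  ultimately show ?thesis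
    unfolding trunc_splines_def graph_splines_def by auto
qed

section \<open>Pieces of spline functions and the spline space\<close>

context
  fixes \<Delta> :: "(real ^ 'n::finite) set set"
  assumes complex: "simplicial_complex \<Delta>"
begin

lemma piece_eqI:
  assumes "v \<in> dual_vertices \<Delta>" "\<And>x. x \<in> v \<Longrightarrow> F x = poly_eval p x"
  shows "piece F v = p"
  unfolding piece_def
proof (rule the_equality)
  show "\<forall>x\<in>v. F x = poly_eval p x" using assms(2) by blast
  show "q = p" if "\<forall>x\<in>v. F x = poly_eval q x" for q
    using poly_eval_inject_convex[OF dual_vertex_convex[OF complex assms(1)]
        dual_vertex_affine_hull[OF complex assms(1)]] that assms(2) by metis
qed

lemma spline_function_piece:
  assumes "F \<in> spline_functions r d \<Delta>" "v \<in> dual_vertices \<Delta>"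
  shows "degree_le d (piece F v)" "\<And>x. x \<in> v \<Longrightarrow> F x = poly_eval (piece F v) x"
proof -
  obtain p where p: "degree_le d p" "\<And>x. x \<in> v \<Longrightarrow> F x = poly_eval p x"
    using assms by (auto simp: spline_functions_def)
  then have "piece F v = p" by (intro piece_eqI[OF assms(2)])
  then show "degree_le d (piece F v)" "\<And>x. x \<in> v \<Longrightarrow> F x = poly_eval (piece F v) x"
    using p by auto
qed

lemma spline_function_dvd:
  assumes F: "F \<in> spline_functions r d \<Delta>" "restricts_to \<Delta> F P"
    and uv: "u \<in> dual_vertices \<Delta>" "v \<in> dual_vertices \<Delta>" and a: "label_form {u, v} a"
  shows "linear_poly a ^ Suc r dvd P u - P v"
proof (rule Ck_on_pieces_dvd[where S = "\<Union>\<Delta>" and u = u and v = v])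
  show "Ck_on r (\<Union>\<Delta>) F" using F(1) by (simp add: spline_functions_def)
  show "u \<subseteq> \<Union>\<Delta>" "v \<subseteq> \<Union>\<Delta>" using uv by (auto simp: dual_vertices_def)
  show "F x = poly_eval (P u) x" if "x \<in> u" for x
    using F(2) uv(1) that by (auto simp: restricts_to_def)
  show "F x = poly_eval (P v) x" if "x \<in> v" for x
    using F(2) uv(2) that by (auto simp: restricts_to_def)
  show "a \<noteq> 0" "{x. a \<bullet> x = 0} \<subseteq> affine hull (u \<inter> v)" using a by (auto simp: label_form_def)
qed (use uv dual_vertex_closed[OF complex] dual_vertex_convex[OF complex]
    dual_vertex_interior[OF complex] in auto)

text \<open>Every facet crossed by the dual path through \<open>x\<close> contains \<open>x\<close>,
  so its linear form vanishes there and divisibility yields equal jets across it; transitivity of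
  jet equality does the rest.\<close>

lemma spline_function_glue:
  assumes cdim: "complex_dim (int CARD('n)) \<Delta>" and pure: "pure_complex \<Delta>"
    and links: "\<And>\<sigma>. \<sigma> \<in> \<Delta> \<Longrightarrow> strongly_connected (link \<Delta> \<sigma>)"
    and P: "\<And>v. v \<in> dual_vertices \<Delta> \<Longrightarrow> degree_le d (P v)"
    and label: "\<And>e. e \<in> dual_edges \<Delta> \<Longrightarrow> label_form e (a e)"
    and dvd: "\<And>u v. u \<in> dual_vertices \<Delta> \<Longrightarrow> v \<in> dual_vertices \<Delta> \<Longrightarrow> {u, v} \<in> dual_edges \<Delta> \<Longrightarrow>
      linear_poly (a {u, v}) ^ Suc r dvd P u - P v"
  shows "\<exists>F\<in>spline_functions r d \<Delta>. restricts_to \<Delta> F P"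
proof -
  let ?V = "dual_vertices \<Delta>"
  have jet: "jet_eq r (P u) (P v) x" if uv: "u \<in> ?V" "v \<in> ?V" "x \<in> u" "x \<in> v" for u v x
  proof -
    have "(\<lambda>a b. a \<in> ?V \<and> b \<in> ?V \<and> {a, b} \<in> dual_edges \<Delta> \<and> x \<in> a \<inter> b)\<^sup>*\<^sup>* u v"
      by (rule dual_path[OF complex cdim _ uv]) (rule links)
    then show ?thesis
    proof (induction rule: rtranclp_induct)
      case base
      show ?case by (rule jet_eq_refl)
    next
      case (step y z)
      then have e: "{y, z} \<in> dual_edges \<Delta>" "y \<in> ?V" "z \<in> ?V" and x: "x \<in> y \<inter> z" by auto
      have "a {y, z} \<bullet> x = 0"
        using label[OF e(1)] hull_inc[OF x, of affine] by (simp add: label_form_def)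
      then have "jet_eq r (P y) (P z) x" by (rule jet_eq_if_power_dvd[OF dvd[OF e(2,3,1)]])
      with step.IH show ?case by (rule jet_eq_trans)
    qed
  qed
  have Un: "\<Union>\<Delta> = \<Union>?V" using Union_dual_vertices[OF complex cdim pure] by simp
  \<comment> \<open>Any n-simplex containing the point may define the value, since jet equality
    includes equality of values.\<close>
  define F where "F = (\<lambda>x\<in>\<Union>\<Delta>. poly_eval (P (SOME v. v \<in> ?V \<and> x \<in> v)) x)"
  have F: "F x = poly_eval (P v) x" if v: "v \<in> ?V" "x \<in> v" for v x
  proof -
    define u where "u = (SOME v. v \<in> ?V \<and> x \<in> v)"
    have "u \<in> ?V \<and> x \<in> u" unfolding u_def by (rule someI[of _ v]) (use v in blast)
    then have "poly_eval (P u) x = poly_eval (P v) x"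
      by (intro jet_eq_imp_eval_eq[OF jet[of u v x]]) (simp_all add: v)
    moreover have "x \<in> \<Union>\<Delta>" using Un v by blast
    ultimately show ?thesis by (simp add: F_def u_def)
  qed
  have "Ck_on r (\<Union>?V) F"
    by (rule Ck_on_glue[OF finite_dual_vertices[OF complex] dual_vertex_closed[OF complex] F jet])
  then have "F \<in> spline_functions r d \<Delta>"
    unfolding spline_functions_def Un
  proof (intro CollectI conjI ballI)
    show "F \<in> \<Union>?V \<rightarrow>\<^sub>E UNIV" unfolding F_def Un by simp
    show "\<exists>p. degree_le d p \<and> (\<forall>x\<in>v. F x = poly_eval p x)" if "v \<in> ?V" for v
      using P[OF that] F[OF that] by blast
  qed
  then show ?thesis using F by (auto simp: restricts_to_def)
qed

text \<open>The second claim is what additivity of \<open>phi\<close> needs, as \<open>phi\<close>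
  is computed from \<open>piece\<close>; it follows from uniqueness of the polynomial on an
  n-simplex.\<close>

lemma spline_functions_add:
  assumes F: "F \<in> spline_functions r d \<Delta>" and G: "G \<in> spline_functions r d \<Delta>"
  shows "(\<lambda>x\<in>\<Union>\<Delta>. F x + G x) \<in> spline_functions r d \<Delta>"
    and "v \<in> dual_vertices \<Delta> \<Longrightarrow> piece (\<lambda>x\<in>\<Union>\<Delta>. F x + G x) v = piece F v + piece G v"
proof -
  let ?H = "\<lambda>x\<in>\<Union>\<Delta>. F x + G x"
  have H: "?H x = poly_eval (piece F v + piece G v) x" if v: "v \<in> dual_vertices \<Delta>" "x \<in> v" for v x
    using v spline_function_piece(2)[OF F v] spline_function_piece(2)[OF G v]
    by (auto simp: dual_vertices_def)
  have "Ck_on r (\<Union>\<Delta>) ?H \<longleftrightarrow> Ck_on r (\<Union>\<Delta>) (\<lambda>x. F x + G x)" by (rule Ck_on_cong) simp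
  then have "Ck_on r (\<Union>\<Delta>) ?H" using F G by (simp add: Ck_on_add spline_functions_def)
  moreover have "\<exists>p. degree_le d p \<and> (\<forall>x\<in>v. ?H x = poly_eval p x)" if v: "v \<in> dual_vertices \<Delta>" for v
    by (intro exI[of _ "piece F v + piece G v"] conjI ballI H[OF v] degree_le_add
        spline_function_piece(1)[OF F v] spline_function_piece(1)[OF G v])
  ultimately show "?H \<in> spline_functions r d \<Delta>" by (auto simp: spline_functions_def)
  show "piece ?H v = piece F v + piece G v" if "v \<in> dual_vertices \<Delta>"
    by (rule piece_eqI[OF that H[OF that]])
qed

lemma spline_functions_smult:
  assumes F: "F \<in> spline_functions r d \<Delta>"
  shows "(\<lambda>x\<in>\<Union>\<Delta>. c * F x) \<in> spline_functions r d \<Delta>"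
    and "v \<in> dual_vertices \<Delta> \<Longrightarrow> piece (\<lambda>x\<in>\<Union>\<Delta>. c * F x) v = poly_const c * piece F v"
proof -
  let ?H = "\<lambda>x\<in>\<Union>\<Delta>. c * F x"
  have H: "?H x = poly_eval (poly_const c * piece F v) x" if v: "v \<in> dual_vertices \<Delta>" "x \<in> v" for v x
    using v spline_function_piece(2)[OF F v] by (auto simp: dual_vertices_def)
  have "Ck_on r (\<Union>\<Delta>) ?H \<longleftrightarrow> Ck_on r (\<Union>\<Delta>) (\<lambda>x. c * F x)" by (rule Ck_on_cong) simp
  then have "Ck_on r (\<Union>\<Delta>) ?H" using F by (simp add: Ck_on_mult_const spline_functions_def)
  moreover have "\<exists>p. degree_le d p \<and> (\<forall>x\<in>v. ?H x = poly_eval p x)" if v: "v \<in> dual_vertices \<Delta>" for v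
    using degree_le_mult[OF degree_le_const[of 0 c] spline_function_piece(1)[OF F v]]
    by (intro exI[of _ "poly_const c * piece F v"] conjI ballI H[OF v]) simp_all
  ultimately show "?H \<in> spline_functions r d \<Delta>" by (auto simp: spline_functions_def)
  show "piece ?H v = poly_const c * piece F v" if "v \<in> dual_vertices \<Delta>"
    by (rule piece_eqI[OF that H[OF that]])
qed

lemma spline_functions_zero:
  shows "(\<lambda>x\<in>\<Union>\<Delta>. 0) \<in> spline_functions r d \<Delta>"
    and "v \<in> dual_vertices \<Delta> \<Longrightarrow> piece (\<lambda>x\<in>\<Union>\<Delta>. 0) v = 0"
proof -
  let ?H = "\<lambda>x\<in>\<Union>\<Delta>. 0 :: real"
  have H: "?H x = poly_eval 0 x" if v: "v \<in> dual_vertices \<Delta>" "x \<in> v" for v x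
    using v by (auto simp: dual_vertices_def)
  have "Ck_on r (\<Union>\<Delta>) ?H \<longleftrightarrow> Ck_on r (\<Union>\<Delta>) (\<lambda>x. 0)" by (rule Ck_on_cong) simp
  then have "Ck_on r (\<Union>\<Delta>) ?H" by (simp add: Ck_on_const)
  moreover have "\<exists>p. degree_le d p \<and> (\<forall>x\<in>v. ?H x = poly_eval p x)" if v: "v \<in> dual_vertices \<Delta>" for v
    by (intro exI[of _ 0] conjI ballI H[OF v]) (simp_all add: degree_le_def)
  ultimately show "?H \<in> spline_functions r d \<Delta>" by (auto simp: spline_functions_def)
  show "piece ?H v = 0" if "v \<in> dual_vertices \<Delta>"
    by (rule piece_eqI[OF that H[OF that]])
qed

lemma module_spline_space: "module real_ring (spline_space r d \<Delta>)"
proof -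
  let ?M = "spline_space r d \<Delta>"
  note M = spline_space_def
  have ext: "F = G" if "F \<in> spline_functions r d \<Delta>" "G \<in> spline_functions r d \<Delta>"
    "\<And>x. x \<in> \<Union>\<Delta> \<Longrightarrow> F x = G x" for F G
    using that by (intro PiE_ext[of F "\<Union>\<Delta>" "\<lambda>_. UNIV" G]) (auto simp: spline_functions_def)
  have "abelian_group ?M"
  proof (rule abelian_groupI)
    show "\<exists>G\<in>carrier ?M. G \<oplus>\<^bsub>?M\<^esub> F = \<zero>\<^bsub>?M\<^esub>" if "F \<in> carrier ?M" for F
      using that spline_functions_smult(1)[of F r d "- 1"]
      by (intro bexI[of _ "\<lambda>x\<in>\<Union>\<Delta>. - 1 * F x"]) (auto simp: M fun_eq_iff)
    show "\<zero>\<^bsub>?M\<^esub> \<oplus>\<^bsub>?M\<^esub> F = F" if "F \<in> carrier ?M" for F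
      using that spline_functions_add(1)[OF spline_functions_zero(1)] by (intro ext) (auto simp: M)
  qed (auto simp: M spline_functions_add spline_functions_zero fun_eq_iff)
  then show ?thesis
  proof (rule moduleI[OF cring_from_type_algebra])
    show "\<one>\<^bsub>real_ring\<^esub> \<odot>\<^bsub>?M\<^esub> F = F" if "F \<in> carrier ?M" for F
      using that spline_functions_smult(1)[of F r d 1] by (intro ext) (auto simp: M)
  qed (auto simp: M spline_functions_smult fun_eq_iff algebra_simps)
qed

end

text \<open>Two splines with the same image have pieces of degree at most \<open>d\<close> that
  agree modulo order above \<open>d\<close>, hence equal pieces. Conversely, representatives of
  degree at most \<open>d\<close> of a graph spline satisfy the divisibilities along edges and glue
  to a spline function.\<close>

lemma phi_spline_space_iso:
  fixes \<Delta> :: "(real ^ 'n::finite) set set"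
  assumes complex: "simplicial_complex \<Delta>"
    and cdim: "complex_dim (int CARD('n)) \<Delta>"
    and pure: "pure_complex \<Delta>"
    and links: "\<And>\<sigma>. \<sigma> \<in> \<Delta> \<Longrightarrow> strongly_connected (link \<Delta> \<sigma>)"
    and label: "\<And>e. e \<in> dual_edges \<Delta> \<Longrightarrow> label_form e (a e)"
  shows "module_iso real_ring (spline_space r d \<Delta>)
    (restrict_scalars (\<lambda>c. trunc_map (d + 1) (poly_const c)) (trunc_splines r d \<Delta>)) (phi d \<Delta>)"
proof (rule module_iso_transport[OF module_spline_space[OF complex]])
  let ?N = "restrict_scalars (\<lambda>c. trunc_map (d + 1) (poly_const c)) (trunc_splines r d \<Delta>)"
  let ?V = "dual_vertices \<Delta>"
  have carriers: "carrier (spline_space r d \<Delta>) = spline_functions r d \<Delta>"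
    "carrier ?N = carrier (trunc_splines r d \<Delta>)"
    by (simp_all add: spline_space_def restrict_scalars_def)
  show "bij_betw (phi d \<Delta>) (carrier (spline_space r d \<Delta>)) (carrier ?N)"
    unfolding carriers
  proof (rule bij_betw_imageI)
    show "inj_on (phi d \<Delta>) (spline_functions r d \<Delta>)"
    proof (rule inj_onI)
      fix F G assume F: "F \<in> spline_functions r d \<Delta>" and G: "G \<in> spline_functions r d \<Delta>"
        and eq: "phi d \<Delta> F = phi d \<Delta> G"
      have "piece F v = piece G v" if v: "v \<in> ?V" for v
      proof -
        have "order_ge (Suc d) (piece F v - piece G v)"
          using fun_cong[OF eq, of v] v by (simp add: phi_def phi_family_def trunc_map_eq_iff)
        moreover have "degree_le d (piece F v - piece G v)"
          by (intro degree_le_diff spline_function_piece(1)[OF complex F v]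
              spline_function_piece(1)[OF complex G v])
        ultimately show ?thesis using degree_order_disjoint by fastforce
      qed
      then have "F x = G x" if "x \<in> \<Union>\<Delta>" for x
        using that spline_function_piece(2)[OF complex F] spline_function_piece(2)[OF complex G]
        unfolding Union_dual_vertices[OF complex cdim pure, symmetric] by fastforce
      then show "F = G"
        using F G by (intro PiE_ext[of F "\<Union>\<Delta>" "\<lambda>_. UNIV" G]) (auto simp: spline_functions_def)
    qed
    show "phi d \<Delta> ` spline_functions r d \<Delta> = carrier (trunc_splines r d \<Delta>)"
    proof (intro equalityI subsetI)
      fix q assume "q \<in> phi d \<Delta> ` spline_functions r d \<Delta>"
      then obtain F where F: "F \<in> spline_functions r d \<Delta>" and q: "q = phi d \<Delta> F" by blast
      have "restricts_to \<Delta> F (piece F)"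
        using spline_function_piece(2)[OF complex F] by (simp add: restricts_to_def)
      then have "linear_poly (a {u, v}) ^ Suc r dvd piece F u - piece F v"
        if "u \<in> ?V" "v \<in> ?V" "{u, v} \<in> dual_edges \<Delta>" for u v
        using spline_function_dvd[OF complex F _ that(1,2) label[OF that(3)]] by blast
      then show "q \<in> carrier (trunc_splines r d \<Delta>)"
        unfolding q phi_def
        by (subst phi_family_in_carrier_iff[where a = a])
          (use spline_function_piece(1)[OF complex F] label in blast)+
    next
      fix q assume q: "q \<in> carrier (trunc_splines r d \<Delta>)"
      then have q': "q \<in> ?V \<rightarrow>\<^sub>E carrier (trunc_ring (d + 1))"
        by (simp add: trunc_splines_def graph_splines_def)
      have "\<exists>p. degree_le d p \<and> q v = trunc_map (d + 1) p" if v: "v \<in> ?V" for v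
      proof -
        have "q v \<in> range (trunc_map (d + 1))"
          using PiE_mem[OF q' v] by (simp only: carrier_trunc_ring)
        then obtain p where p: "q v = trunc_map (d + 1) p" by blast
        \<comment> \<open>Dropping the part of order above \<open>d\<close> does not change the
          class.\<close>
        obtain b c where bc: "p = b + c" "degree_le d b" "order_ge (Suc d) c"
          using degree_order_decompose by blast
        then have "q v = trunc_map (d + 1) b" by (simp add: p trunc_map_eq_iff)
        then show ?thesis using bc(2) by blast
      qed
      then obtain P where P: "\<And>v. v \<in> ?V \<Longrightarrow> degree_le d (P v)"
        "\<And>v. v \<in> ?V \<Longrightarrow> q v = trunc_map (d + 1) (P v)"
        by metis
      have qP: "q = phi_family d \<Delta> P"
        by (rule extensionalityI[of _ ?V]) (use q' P(2) in \<open>auto simp: phi_family_def PiE_def\<close>)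
      have "phi_family d \<Delta> P \<in> carrier (trunc_splines r d \<Delta>) \<longleftrightarrow>
          (\<forall>u\<in>?V. \<forall>v\<in>?V. {u, v} \<in> dual_edges \<Delta> \<longrightarrow>
            linear_poly (a {u, v}) ^ Suc r dvd P u - P v)"
        by (rule phi_family_in_carrier_iff) (rule P(1) label, assumption)+
      then have "\<And>u v. u \<in> ?V \<Longrightarrow> v \<in> ?V \<Longrightarrow> {u, v} \<in> dual_edges \<Delta> \<Longrightarrow>
          linear_poly (a {u, v}) ^ Suc r dvd P u - P v"
        using q qP by blast
      then have "\<exists>F\<in>spline_functions r d \<Delta>. restricts_to \<Delta> F P"
        by (rule spline_function_glue[OF complex cdim pure, rotated -1])
          (assumption | rule links P(1) label, assumption)+
      then obtain F where F: "F \<in> spline_functions r d \<Delta>" "restricts_to \<Delta> F P" by blast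
      then have "phi d \<Delta> F = q"
        unfolding qP phi_def phi_family_def
        by (intro restrict_ext) (auto simp: restricts_to_def intro!: arg_cong[OF piece_eqI[OF complex]])
      then show "q \<in> phi d \<Delta> ` spline_functions r d \<Delta>" using F(1) by blast
    qed
  qed
  show "phi d \<Delta> (F \<oplus>\<^bsub>spline_space r d \<Delta>\<^esub> G) = phi d \<Delta> F \<oplus>\<^bsub>?N\<^esub> phi d \<Delta> G"
    if "F \<in> carrier (spline_space r d \<Delta>)" "G \<in> carrier (spline_space r d \<Delta>)" for F G
    using that spline_functions_add(2)[OF complex, of F r d G]
    by (auto simp: spline_space_def restrict_scalars_def trunc_splines_def graph_splines_def
        phi_def phi_family_def trunc_map_add intro!: restrict_ext)
  show "phi d \<Delta> (c \<odot>\<^bsub>spline_space r d \<Delta>\<^esub> F) = c \<odot>\<^bsub>?N\<^esub> phi d \<Delta> F"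
    if "F \<in> carrier (spline_space r d \<Delta>)" for c F
    using that spline_functions_smult(2)[OF complex, of F r d _ c]
    by (auto simp: spline_space_def restrict_scalars_def trunc_splines_def graph_splines_def
        phi_def phi_family_def trunc_map_mult intro!: restrict_ext)
  show "phi d \<Delta> \<zero>\<^bsub>spline_space r d \<Delta>\<^esub> = \<zero>\<^bsub>?N\<^esub>"
    using spline_functions_zero(2)[OF complex]
    by (auto simp: spline_space_def restrict_scalars_def trunc_splines_def graph_splines_def
        phi_def phi_family_def trunc_map_0 intro!: restrict_ext)
qed

theorem corollary6p6:
  fixes r d :: nat
    and \<Delta> :: "(real ^ 'n::finite) set set"
  assumes "simplicial_complex \<Delta>"
    and "complex_dim (int CARD('n)) \<Delta>"
    and "strongly_connected \<Delta>"
    and "\<And>\<sigma>. \<sigma> \<in> \<Delta> \<Longrightarrow> strongly_connected (link \<Delta> \<sigma>)"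
    and "\<And>e. e \<in> dual_edges \<Delta> \<Longrightarrow>
           \<exists>g :: 'n mpoly. homogeneous g \<and> dual_label e = PIdl\<^bsub>mpoly_ring\<^esub> g"
  shows "(\<forall>P. (\<forall>v\<in>dual_vertices \<Delta>. degree_le d (P v)) \<longrightarrow>
             ((\<exists>F\<in>spline_functions r d \<Delta>. restricts_to \<Delta> F P) \<longleftrightarrow>
              phi_family d \<Delta> P \<in> carrier (trunc_splines r d \<Delta>))) \<and>
         module_iso real_ring
           (spline_space r d \<Delta>)
           (restrict_scalars (\<lambda>c. trunc_map (d + 1) (poly_const c)) (trunc_splines r d \<Delta>))
           (phi d \<Delta>) \<and>
         (\<forall>(f :: 'n mpoly). \<forall>F\<in>spline_functions r d \<Delta>.
           (\<lambda>x\<in>\<Union>\<Delta>. poly_eval f x * F x) \<in> spline_functions r d \<Delta> \<longrightarrow>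
             phi d \<Delta> (\<lambda>x\<in>\<Union>\<Delta>. poly_eval f x * F x)
               = f \<odot>\<^bsub>restrict_scalars (trunc_map (d + 1)) (trunc_splines r d \<Delta>)\<^esub> phi d \<Delta> F \<and>
             f \<odot>\<^bsub>restrict_scalars (trunc_map (d + 1)) (trunc_splines r d \<Delta>)\<^esub> phi d \<Delta> F
               = trunc_map (d + 1) f \<odot>\<^bsub>trunc_splines r d \<Delta>\<^esub> phi d \<Delta> F) \<and>
         (\<forall>F1\<in>spline_functions r d \<Delta>. \<forall>F2\<in>spline_functions r d \<Delta>.
           (\<lambda>x\<in>\<Union>\<Delta>. F1 x * F2 x) \<in> spline_functions r d \<Delta> \<longrightarrow>
             phi d \<Delta> (\<lambda>x\<in>\<Union>\<Delta>. F1 x * F2 x)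
               = phi d \<Delta> F1 \<otimes>\<^bsub>trunc_splines r d \<Delta>\<^esub> phi d \<Delta> F2)"
proof (intro conjI allI ballI impI)
  let ?V = "dual_vertices \<Delta>"
  note complex = assms(1) and cdim = assms(2)
  have pure: "pure_complex \<Delta>" using assms(3) by (simp add: strongly_connected_def)
  have "\<forall>e\<in>dual_edges \<Delta>. \<exists>a. label_form e a"
    using assms(5) dual_edge_label_form by blast
  then obtain a where label: "\<And>e. e \<in> dual_edges \<Delta> \<Longrightarrow> label_form e (a e)"
    by metis
  show "(\<exists>F\<in>spline_functions r d \<Delta>. restricts_to \<Delta> F P) \<longleftrightarrow>
      phi_family d \<Delta> P \<in> carrier (trunc_splines r d \<Delta>)"
    if "\<forall>v\<in>?V. degree_le d (P v)" for P
  proof -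
    have P: "\<And>v. v \<in> ?V \<Longrightarrow> degree_le d (P v)" using that by blast
    have iff: "phi_family d \<Delta> P \<in> carrier (trunc_splines r d \<Delta>) \<longleftrightarrow>
        (\<forall>u\<in>?V. \<forall>v\<in>?V. {u, v} \<in> dual_edges \<Delta> \<longrightarrow>
          linear_poly (a {u, v}) ^ Suc r dvd P u - P v)"
      by (rule phi_family_in_carrier_iff) (rule P label, assumption)+
    show ?thesis
    proof
      assume "\<exists>F\<in>spline_functions r d \<Delta>. restricts_to \<Delta> F P"
      then obtain F where F: "F \<in> spline_functions r d \<Delta>" "restricts_to \<Delta> F P" by blast
      show "phi_family d \<Delta> P \<in> carrier (trunc_splines r d \<Delta>)"
        unfolding iff by (intro ballI impI spline_function_dvd[OF complex F] label)
    next
      assume "phi_family d \<Delta> P \<in> carrier (trunc_splines r d \<Delta>)"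
      then have "\<And>u v. u \<in> ?V \<Longrightarrow> v \<in> ?V \<Longrightarrow> {u, v} \<in> dual_edges \<Delta> \<Longrightarrow>
          linear_poly (a {u, v}) ^ Suc r dvd P u - P v"
        unfolding iff by blast
      then show "\<exists>F\<in>spline_functions r d \<Delta>. restricts_to \<Delta> F P"
        by (rule spline_function_glue[OF complex cdim pure, rotated -1])
          (assumption | rule assms(4) P label, assumption)+
    qed
  qed
  show "module_iso real_ring (spline_space r d \<Delta>)
      (restrict_scalars (\<lambda>c. trunc_map (d + 1) (poly_const c)) (trunc_splines r d \<Delta>)) (phi d \<Delta>)"
    by (rule phi_spline_space_iso[OF complex cdim pure]) (rule assms(4) label, assumption)+
  show "f \<odot>\<^bsub>restrict_scalars (trunc_map (d + 1)) (trunc_splines r d \<Delta>)\<^esub> phi d \<Delta> F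
      = trunc_map (d + 1) f \<odot>\<^bsub>trunc_splines r d \<Delta>\<^esub> phi d \<Delta> F" for f F
    by (simp add: restrict_scalars_def)
  show "phi d \<Delta> (\<lambda>x\<in>\<Union>\<Delta>. poly_eval f x * F x)
      = f \<odot>\<^bsub>restrict_scalars (trunc_map (d + 1)) (trunc_splines r d \<Delta>)\<^esub> phi d \<Delta> F"
    if F: "F \<in> spline_functions r d \<Delta>" for f F
  proof -
    \<comment> \<open>Both sides agree at the points of \<open>v\<close>, where the representing
      polynomial is unique; multiplicativity of \<open>trunc_map\<close> then finishes the
      argument.\<close>
    have "piece (\<lambda>x\<in>\<Union>\<Delta>. poly_eval f x * F x) v = f * piece F v" if v: "v \<in> ?V" for v
      using v spline_function_piece(2)[OF complex F v]
      by (intro piece_eqI[OF complex v]) (auto simp: dual_vertices_def)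
    then show ?thesis
      by (auto simp: restrict_scalars_def trunc_splines_def graph_splines_def
          phi_def phi_family_def trunc_map_mult intro!: restrict_ext)
  qed
  show "phi d \<Delta> (\<lambda>x\<in>\<Union>\<Delta>. F1 x * F2 x) = phi d \<Delta> F1 \<otimes>\<^bsub>trunc_splines r d \<Delta>\<^esub> phi d \<Delta> F2"
    if F1: "F1 \<in> spline_functions r d \<Delta>" and F2: "F2 \<in> spline_functions r d \<Delta>" for F1 F2
  proof -
    have "piece (\<lambda>x\<in>\<Union>\<Delta>. F1 x * F2 x) v = piece F1 v * piece F2 v" if v: "v \<in> ?V" for v
      using v spline_function_piece(2)[OF complex F1 v] spline_function_piece(2)[OF complex F2 v]
      by (intro piece_eqI[OF complex v]) (auto simp: dual_vertices_def)
    then show ?thesis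
      by (auto simp: trunc_splines_def graph_splines_def
          phi_def phi_family_def trunc_map_mult intro!: restrict_ext)
  qed
qed

end
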